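(* Let $G$ be a finitely generated infinite group with decidable word problem. Then $G$ admits a translation-like action by $\mathbb{Z}$ that is computable and has decidable orbit membership problem.
   Context: Let $S\subset G$ be a finite generating set (the notions below do not depend on it). For a word $w\in(S\cup S^{-1})^*$, $w_G$ denotes the corresponding element of $G$. $G$ has decidable word problem if $\{w\in(S\cup S^{-1})^*\mid w_G=1_G\}$ is a decidable set. $G$ is endowed with the left-invariant word metric $d_S$, where $d_S(g,h)$ is the length of the shortest word $w$ with $g w_G=h$. A right action $\ast$ of a group $H$ on a metric space $(X,d)$ is translation-like if it is free (that is, $x\ast h=x$ implies $h=1_H$, for $x\in X$, $h\in H$) and for each $h\in H$ the set $\{d(x,x\ast h)\mid x\in X\}\subset\mathbb{R}$ is bounded. A numbering of a set $X$ is a bijection $\nu\colon N\to X$ with $N$ a decidable subset of $\mathbb{N}$; functions between numbered sets are called computable when they become computable (partial) functions on natural numbers after passing to names, and products of numbered sets carry the numbering, unique up to equivalence, making the projections computable. A numbering of a group $G$ is computable if it makes the group operation $G^2\to G$ computable. A finitely generated group with decidable word problem admits a computable numbering, and any two such numberings are equivalent (the identity map is computable from one to the other). An action $\ast$ of $\mathbb{Z}$ on $G$ is computable if the function $G\times\mathbb{Z}\to G$, $(g,n)\mapsto g\ast n$, is computable with respect to a computable numbering of $G$. An action of a group $H$ on the set $G$ has decidable orbit membership problem if there is an algorithm which, given two words $u,v\in(S\cup S^{-1})^*$, decides whether $u_G$ and $v_G$ lie in the same orbit of the action. *)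

theory Defs
  imports
    "HOL-Analysis.Analysis"
    "HOL-Algebra.Elementary_Groups"
    "HOL-Library.Nat_Bijection"
begin

section \<open>Partial recursive functions\<close>

text \<open>
  Codes for Kleene's partial recursive functions, interpreted as partial functions on tuples of
  natural numbers; \<^term>\<open>None\<close> stands for divergence. Arities are not tracked:
  \<open>Zero\<close> accepts every tuple, and a call lacking a required argument diverges. In \<open>Prec f g\<close> the first argument is the recursion
  argument, and \<open>g\<close> receives the previous value, the counter and the parameters, in this
  order. \<open>Mn f\<close> is unbounded minimization over the first argument of \<open>f\<close>; it converges
  to \<open>n\<close> iff \<open>f\<close> converges to \<open>0\<close> at \<open>n\<close> and to nonzero values before \<open>n\<close>.
\<close>

datatype recf =
    Zero
  | Succ
  | Proj nat
  | Comp recf "recf list"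
  | Prec recf recf
  | Mn recf

fun recf_eval :: "recf \<Rightarrow> nat list \<Rightarrow> nat option" where
  "recf_eval Zero xs = Some 0"
| "recf_eval Succ xs = (case xs of [x] \<Rightarrow> Some (Suc x) | _ \<Rightarrow> None)"
| "recf_eval (Proj i) xs = (if i < length xs then Some (xs ! i) else None)"
| "recf_eval (Comp f gs) xs =
    (let ys = map (\<lambda>g. recf_eval g xs) gs
     in if None \<in> set ys then None else recf_eval f (map the ys))"
| "recf_eval (Prec f g) xs =
    (case xs of
       [] \<Rightarrow> None
     | n # zs \<Rightarrow>
         rec_nat (recf_eval f zs)
           (\<lambda>m r. case r of None \<Rightarrow> None | Some y \<Rightarrow> recf_eval g (y # m # zs)) n)"
| "recf_eval (Mn f) xs =
    (let halts_at = (\<lambda>n. recf_eval f (n # xs) = Some 0 \<and>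
                        (\<forall>m<n. \<exists>y. recf_eval f (m # xs) = Some (Suc y)))
     in if \<exists>n. halts_at n then Some (THE n. halts_at n) else None)"

definition partial_recursive :: "(nat \<rightharpoonup> nat) \<Rightarrow> bool" where
  "partial_recursive f \<longleftrightarrow> (\<exists>p. \<forall>n. recf_eval p [n] = f n)"

definition decidable_set :: "nat set \<Rightarrow> bool" where
  "decidable_set A \<longleftrightarrow> partial_recursive (\<lambda>n. Some (if n \<in> A then 1 else 0))"


section \<open>Numberings\<close>

definition numbering :: "nat set \<Rightarrow> (nat \<Rightarrow> 'a) \<Rightarrow> 'a set \<Rightarrow> bool" where
  "numbering N \<nu> X \<longleftrightarrow> decidable_set N \<and> bij_betw \<nu> N X"

text \<open>
  The function induced by \<open>f\<close> on names is the partial function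
  \<open>\<mu>\<^sup>-\<^sup>1 \<circ> f \<circ> \<nu>\<close> with domain exactly \<open>N\<close>.
\<close>

definition computable_map ::
  "nat set \<Rightarrow> (nat \<Rightarrow> 'a) \<Rightarrow> nat set \<Rightarrow> (nat \<Rightarrow> 'b) \<Rightarrow> ('a \<Rightarrow> 'b) \<Rightarrow> bool" where
  "computable_map N \<nu> M \<mu> f \<longleftrightarrow>
     partial_recursive (\<lambda>n. if n \<in> N then Some (inv_into M \<mu> (f (\<nu> n))) else None)"

text \<open>
  The product numbering names a pair by the \<^const>\<open>prod_encode\<close>-code (Cantor pairing) of
  the names of its components.
\<close>

definition prod_names :: "nat set \<Rightarrow> nat set \<Rightarrow> nat set" where
  "prod_names N M = prod_encode ` (N \<times> M)"

definition prod_numbering :: "(nat \<Rightarrow> 'a) \<Rightarrow> (nat \<Rightarrow> 'b) \<Rightarrow> nat \<Rightarrow> 'a \<times> 'b" where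
  "prod_numbering \<nu> \<mu> n = map_prod \<nu> \<mu> (prod_decode n)"

definition computable_group_numbering ::
  "('a, 'b) monoid_scheme \<Rightarrow> nat set \<Rightarrow> (nat \<Rightarrow> 'a) \<Rightarrow> bool" where
  "computable_group_numbering G N \<nu> \<longleftrightarrow>
     numbering N \<nu> (carrier G) \<and>
     computable_map (prod_names N N) (prod_numbering \<nu> \<nu>) N \<nu> (\<lambda>(g, h). g \<otimes>\<^bsub>G\<^esub> h)"


section \<open>Words, word problem and word metric\<close>

definition letters :: "('a, 'b) monoid_scheme \<Rightarrow> 'a set \<Rightarrow> 'a set" where
  "letters G S = S \<union> m_inv G ` S"

definition word_value :: "('a, 'b) monoid_scheme \<Rightarrow> 'a list \<Rightarrow> 'a" where
  "word_value G w = foldr (\<lambda>x y. x \<otimes>\<^bsub>G\<^esub> y) w \<one>\<^bsub>G\<^esub>"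

text \<open>
  A set of words, or of pairs of words, over a finite alphabet \<open>A\<close> is decidable if its set of
  codes is, where the letters are coded by an enumeration \<open>e\<close> of the alphabet. Two
  enumerations differ by a permutation of a finite set, so the choice of \<open>e\<close> is immaterial.
\<close>

definition word_code :: "('a \<Rightarrow> nat) \<Rightarrow> 'a list \<Rightarrow> nat" where
  "word_code e w = list_encode (map e w)"

definition decidable_words :: "'a set \<Rightarrow> 'a list set \<Rightarrow> bool" where
  "decidable_words A L \<longleftrightarrow>
     (\<exists>e. bij_betw e A {..<card A} \<and> decidable_set (word_code e ` L))"

definition decidable_word_pairs :: "'a set \<Rightarrow> ('a list \<times> 'a list) set \<Rightarrow> bool" where
  "decidable_word_pairs A R \<longleftrightarrow>
     (\<exists>e. bij_betw e A {..<card A} \<and>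
          decidable_set ((\<lambda>(u, v). prod_encode (word_code e u, word_code e v)) ` R))"

definition decidable_word_problem :: "('a, 'b) monoid_scheme \<Rightarrow> 'a set \<Rightarrow> bool" where
  "decidable_word_problem G S \<longleftrightarrow>
     decidable_words (letters G S) {w \<in> lists (letters G S). word_value G w = \<one>\<^bsub>G\<^esub>}"

text \<open>
  The value \<open>0\<close> outside the carrier is a totalization, needed because \<^locale>\<open>Metric_space\<close>
  demands symmetry of the distance function on the whole type.
\<close>

definition word_metric :: "('a, 'b) monoid_scheme \<Rightarrow> 'a set \<Rightarrow> 'a \<Rightarrow> 'a \<Rightarrow> real" where
  "word_metric G S g h =
     (if g \<in> carrier G \<and> h \<in> carrier G
      then real (LEAST n. \<exists>w \<in> lists (letters G S). length w = n \<and> g \<otimes>\<^bsub>G\<^esub> word_value G w = h)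
      else 0)"


section \<open>Actions\<close>

locale right_action = group H for H :: "('h, 'c) monoid_scheme" (structure) +
  fixes X :: "'a set" and act :: "'a \<Rightarrow> 'h \<Rightarrow> 'a"
  assumes act_closed: "\<lbrakk>x \<in> X; h \<in> carrier H\<rbrakk> \<Longrightarrow> act x h \<in> X"
    and act_one: "x \<in> X \<Longrightarrow> act x \<one> = x"
    and act_mult: "\<lbrakk>x \<in> X; h \<in> carrier H; k \<in> carrier H\<rbrakk> \<Longrightarrow> act x (h \<otimes> k) = act (act x h) k"

locale translation_like_action =
  right_action H X act + Metric_space X d
  for H :: "('h, 'c) monoid_scheme" (structure)
    and X :: "'a set" and d :: "'a \<Rightarrow> 'a \<Rightarrow> real" and act :: "'a \<Rightarrow> 'h \<Rightarrow> 'a" +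
  assumes free: "\<lbrakk>x \<in> X; h \<in> carrier H; act x h = x\<rbrakk> \<Longrightarrow> h = \<one>"
    and bounded_displacement: "h \<in> carrier H \<Longrightarrow> bounded {d x (act x h) | x. x \<in> X}"

definition computable_int_action ::
  "('a, 'b) monoid_scheme \<Rightarrow> ('a \<Rightarrow> int \<Rightarrow> 'a) \<Rightarrow> bool" where
  "computable_int_action G act \<longleftrightarrow>
     (\<exists>N \<nu>. computable_group_numbering G N \<nu> \<and>
            computable_map (prod_names N UNIV) (prod_numbering \<nu> int_decode) N \<nu>
              (\<lambda>(g, n). act g n))"

definition action_orbit ::
  "('h, 'c) monoid_scheme \<Rightarrow> ('a \<Rightarrow> 'h \<Rightarrow> 'a) \<Rightarrow> 'a \<Rightarrow> 'a set" where
  "action_orbit H act x = {act x h | h. h \<in> carrier H}"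

definition decidable_orbit_membership ::
  "('a, 'b) monoid_scheme \<Rightarrow> 'a set \<Rightarrow> ('h, 'c) monoid_scheme \<Rightarrow> ('a \<Rightarrow> 'h \<Rightarrow> 'a) \<Rightarrow> bool" where
  "decidable_orbit_membership G S H act \<longleftrightarrow>
     decidable_word_pairs (letters G S)
       {(u, v). u \<in> lists (letters G S) \<and> v \<in> lists (letters G S) \<and>
                action_orbit H act (word_value G u) = action_orbit H act (word_value G v)}"

end

theory Submission
  imports Defs
begin

text \<open>
  The action is built from a single computable permutation \<open>\<sigma>\<close> of the group that moves points a
  bounded distance, has no finite cycles, and has a decidable orbit relation; \<open>\<int>\<close> then acts by
  the powers of \<open>\<sigma>\<close>. There are two reasons for such a permutation to exist, and which of
  them applies depends on the number of ends of the Cayley graph. Only the existence of an algorithm is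
  claimed, so this number need not be found effectively.

  \<^bold>\<open>One end.\<close> Here the action is transitive. It suffices to enumerate the group
  computably and without repetition as \<open>f 0, f 1, f 2, \<dots>\<close> with consecutive elements at
  distance at most 3: the order \<open>\<dots>, f 3, f 1, f 0, f 2, f 4, \<dots>\<close> is then bi-infinite
  with steps of length at most 6. The enumeration is grown as a finite path whose complement stays connected.
  To absorb a further vertex, take a finite connected set containing it and a start next to the
  end of the path, and add to that set all finite components that it cuts off. Because there is only one end, the
  remaining complement is again connected (\<open>one_ended_fill\<close>), and by Sekanina's theorem the
  filled set carries a Hamiltonian path with steps of length at most 3 that ends within distance 2 of the complement
  (\<open>hamiltonian_path_cube\<close>). Whether a complement is connected is not obviously decidable, but
  it has a finite witness, namely a walk outside the path through all neighbours of the path. So the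
  extension can be found by unbounded search (\<open>computable_hamiltonian_ray\<close>).

  \<^bold>\<open>Several ends.\<close> Here \<open>\<sigma>\<close> is right multiplication by a suitable element
  \<open>g\<close>. If a finite connected set \<open>K\<close> has two infinite components in its complement,
  translating \<open>K\<close> into each of them and playing ping-pong yields \<open>g\<close> with
  \<open>g C \<subset> C\<close> for a set \<open>C\<close> with finite boundary (\<open>shrinking_translate\<close>).
  In particular \<open>g\<close> has infinite order. The boundaries of \<open>C, g C, g\<^sup>2 C, \<dots>\<close> all have to be crossed on the way to
  \<open>g\<^sup>m\<close>, and each vertex lies on boundedly many of them, so \<open>m\<close> is at most linear in
  the length of \<open>g\<^sup>m\<close> (\<open>undistorted_element\<close>). Therefore
  membership in a coset of the powers of \<open>g\<close> is decided by a bounded search.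

  All computability is reduced to closure properties of computable maps between types with a coding by
  natural numbers, of which unbounded search (\<open>computable_choice\<close>) is the most important. A group
  with decidable word problem is numbered by the least codes of words that represent its elements
  (\<open>computable_numbering_exists\<close>).
\<close>

section \<open>Computable functions on coded types\<close>

definition rec1 :: "(nat \<Rightarrow> nat) \<Rightarrow> bool" where
  "rec1 f \<longleftrightarrow> partial_recursive (\<lambda>n. Some (f n))"

lemma rec1I: "(\<And>n. recf_eval p [n] = Some (f n)) \<Longrightarrow> rec1 f"
  unfolding rec1_def partial_recursive_def by blast

lemma rec1E:
  assumes "rec1 f" obtains p where "\<And>n. recf_eval p [n] = Some (f n)"
  using assms unfolding rec1_def partial_recursive_def by blast

text \<open>
  The only programs that are written out by hand: enough arithmetic to pair and unpair numbers.
  From then on tuples are coded by single numbers, so that unary functions suffice.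
\<close>
definition rf_add :: recf where "rf_add = Prec (Proj 0) (Comp Succ [Proj 0])"
definition rf_pred :: recf where "rf_pred = Prec Zero (Proj 1)"
definition rf_sub :: recf where "rf_sub = Prec (Proj 0) (Comp rf_pred [Proj 0])"
definition rf_tri :: recf where "rf_tri = Prec Zero (Comp Succ [Comp rf_add [Proj 0, Proj 1]])"
definition rf_pair :: recf where
  "rf_pair = Comp rf_add [Comp rf_tri [Comp rf_add [Proj 0, Proj 1]], Proj 0]"
definition rf_root :: recf where
  "rf_root = Mn (Comp rf_sub [Comp rf_tri [Comp Succ [Proj 0]], Comp Succ [Proj 1]])"
definition rf_fst :: recf where
  "rf_fst = Comp rf_sub [Comp rf_tri [rf_root], Proj 0]"
definition rf_snd :: recf where
  "rf_snd = Comp rf_sub [rf_fst, rf_root]"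

lemma rf_add [simp]: "recf_eval rf_add [m, n] = Some (m + n)"
  unfolding rf_add_def by (induction m) auto

lemma rf_pred [simp]: "recf_eval rf_pred [m] = Some (m - 1)"
  unfolding rf_pred_def by (induction m) auto

lemma rf_sub [simp]: "recf_eval rf_sub [m, n] = Some (n - m)"
  unfolding rf_sub_def by (induction m) auto

lemma rf_tri [simp]: "recf_eval rf_tri [m] = Some (triangle m)"
  unfolding rf_tri_def by (induction m) auto

lemma rf_pair [simp]: "recf_eval rf_pair [m, n] = Some (prod_encode (m, n))"
  by (simp add: rf_pair_def prod_encode_def)

lemma recf_eval_Mn:
  assumes "\<And>m. recf_eval p (m # xs) = Some (F m)" and "F n = 0" and "\<And>m. m < n \<Longrightarrow> F m \<noteq> 0"
  shows "recf_eval (Mn p) xs = Some n"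
proof -
  have *: "F m = 0 \<and> (\<forall>k<m. \<exists>y. F k = Suc y) \<longleftrightarrow> m = n" for m
    using assms(2,3) by (metis linorder_neqE_nat nat.distinct(1) not0_implies_Suc)
  show ?thesis
    by (simp add: assms(1) * Let_def)
qed

lemma triangle_mono: "a \<le> b \<Longrightarrow> triangle a \<le> triangle b"
  by (induction rule: dec_induct) auto

text \<open>
  Unpairing inverts \<^const>\<open>prod_encode\<close> by a search for the largest triangular number not above the code:
  \<open>rf_root\<close> finds its index, which is the sum of the two components.
\<close>
lemma rf_root [simp]: "recf_eval rf_root [prod_encode (a, b)] = Some (a + b)"
  unfolding rf_root_def
proof (rule recf_eval_Mn)
  show "Suc (prod_encode (a, b)) - triangle (Suc (a + b)) = 0"
    by (simp add: prod_encode_def)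
next
  fix m assume "m < a + b"
  then have "triangle (Suc m) \<le> triangle (a + b)"
    by (intro triangle_mono) simp
  then show "Suc (prod_encode (a, b)) - triangle (Suc m) \<noteq> 0"
    by (simp add: prod_encode_def)
qed simp

lemma rf_fst [simp]: "recf_eval rf_fst [prod_encode (a, b)] = Some a"
  by (simp add: rf_fst_def) (simp add: prod_encode_def)

lemma rf_snd [simp]: "recf_eval rf_snd [prod_encode (a, b)] = Some b"
  by (simp add: rf_snd_def)

lemma rec1_id: "rec1 (\<lambda>n. n)"
  by (rule rec1I [where p = "Proj 0"]) simp

lemma rec1_const: "rec1 (\<lambda>n. c)"
proof (induction c)
  case 0
  show ?case by (rule rec1I [where p = Zero]) simp
next
  case (Suc c)
  obtain p where "\<And>n. recf_eval p [n] = Some c" using Suc by (meson rec1E)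
  then show ?case by (intro rec1I [where p = "Comp Succ [p]"]) simp
qed

lemma rec1_compose:
  assumes "rec1 f" "rec1 g" shows "rec1 (\<lambda>n. f (g n))"
proof -
  obtain p q where "\<And>n. recf_eval p [n] = Some (f n)" "\<And>n. recf_eval q [n] = Some (g n)"
    using assms by (meson rec1E)
  then show ?thesis by (intro rec1I [where p = "Comp p [q]"]) simp
qed

lemma rec1_binary:
  assumes r: "\<And>a b. recf_eval r [a, b] = Some (h a b)" and "rec1 f" "rec1 g"
  shows "rec1 (\<lambda>n. h (f n) (g n))"
proof -
  obtain p q where "\<And>n. recf_eval p [n] = Some (f n)" "\<And>n. recf_eval q [n] = Some (g n)"
    using assms by (meson rec1E)
  then show ?thesis by (intro rec1I [where p = "Comp r [p, q]"]) (simp add: r)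
qed

lemma rec1_Suc: "rec1 f \<Longrightarrow> rec1 (\<lambda>n. Suc (f n))"
  by (rule rec1_compose [where f = Suc]) (rule rec1I [where p = Succ], simp)

lemmas rec1_add = rec1_binary [OF rf_add]
lemmas rec1_pair = rec1_binary [OF rf_pair]

lemma rec1_diff: "rec1 f \<Longrightarrow> rec1 g \<Longrightarrow> rec1 (\<lambda>n. f n - g n)"
  using rec1_binary [OF rf_sub, of g f] .

lemma rec1_fst: "rec1 (\<lambda>n. fst (prod_decode n))"
proof (rule rec1I)
  show "recf_eval rf_fst [n] = Some (fst (prod_decode n))" for n
    using rf_fst [of "fst (prod_decode n)" "snd (prod_decode n)"] by simp
qed

lemma rec1_snd: "rec1 (\<lambda>n. snd (prod_decode n))"
proof (rule rec1I)
  show "recf_eval rf_snd [n] = Some (snd (prod_decode n))" for n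
    using rf_snd [of "fst (prod_decode n)" "snd (prod_decode n)"] by simp
qed

lemma rec1_rec_nat:
  assumes "rec1 N" "rec1 f" "rec1 g"
  shows "rec1 (\<lambda>n. rec_nat (f n) (\<lambda>m r. g (prod_encode (n, prod_encode (m, r)))) (N n))"
proof -
  obtain pN pf pg where p: "\<And>n. recf_eval pN [n] = Some (N n)"
      "\<And>n. recf_eval pf [n] = Some (f n)" "\<And>n. recf_eval pg [n] = Some (g n)"
    using assms by (meson rec1E)
  let ?G = "Comp pg [Comp rf_pair [Proj 2, Comp rf_pair [Proj 1, Proj 0]]]"
  have "recf_eval (Prec pf ?G) [k, n] =
      Some (rec_nat (f n) (\<lambda>m r. g (prod_encode (n, prod_encode (m, r)))) k)" for k n
    by (induction k) (simp_all add: p)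
  then show ?thesis
    by (intro rec1I [where p = "Comp (Prec pf ?G) [pN, Proj 0]"]) (simp add: p)
qed

lemma rec1_Least:
  assumes "rec1 F" and ex: "\<And>n. \<exists>m. F (prod_encode (n, m)) = 0"
  shows "rec1 (\<lambda>n. LEAST m. F (prod_encode (n, m)) = 0)"
proof -
  obtain p where p: "\<And>n. recf_eval p [n] = Some (F n)"
    using assms(1) by (meson rec1E)
  show ?thesis
  proof (rule rec1I, rule recf_eval_Mn)
    fix n m
    show "recf_eval (Comp p [Comp rf_pair [Proj 1, Proj 0]]) (m # [n]) = Some (F (prod_encode (n, m)))"
      by (simp add: p)
    show "F (prod_encode (n, LEAST m. F (prod_encode (n, m)) = 0)) = 0"
      using ex by (rule LeastI_ex)
    show "m < (LEAST m. F (prod_encode (n, m)) = 0) \<Longrightarrow> F (prod_encode (n, m)) \<noteq> 0"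
      by (rule not_less_Least)
  qed
qed

text \<open>
  A decoding is total, so that a code stands for some value even if it is outside the range of
  \<open>enc\<close>. The second axiom makes it possible to normalise such a code effectively; it is
  what makes the identity computable.
\<close>
class coded =
  fixes enc :: "'a \<Rightarrow> nat" and dec :: "nat \<Rightarrow> 'a"
  assumes dec_enc [simp]: "dec (enc x) = x"
    and rec1_enc_dec: "rec1 (\<lambda>n. enc (dec n))"

definition computable :: "('a::coded \<Rightarrow> 'b::coded) \<Rightarrow> bool" where
  "computable f \<longleftrightarrow> rec1 (\<lambda>n. enc (f (dec n)))"

text \<open>
  The closure rules have the form \<open>computable f \<Longrightarrow> computable (\<lambda>x. h (f x))\<close>, where
  \<open>x\<close> carries all variables in scope. An operation that binds variables has a premise in which they
  are added to \<open>x\<close> as further components of a pair. This way \<open>intro comp_intros\<close> follows the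
  syntax of a term.
\<close>
named_theorems comp_intros

lemma enc_eq_iff [simp]: "enc x = enc y \<longleftrightarrow> x = y"
  by (metis dec_enc)

lemma computable_id [comp_intros]: "computable (\<lambda>x. x)"
  by (simp add: computable_def rec1_enc_dec)

lemma computable_const [comp_intros]: "computable (\<lambda>x. c)"
  by (simp add: computable_def rec1_const)

lemma computable_compose:
  assumes "computable f" "computable g" shows "computable (\<lambda>x. f (g x))"
  using rec1_compose [OF assms [unfolded computable_def]] by (simp add: computable_def)

instantiation nat :: coded
begin
definition enc_nat :: "nat \<Rightarrow> nat" where "enc_nat n = n"
definition dec_nat :: "nat \<Rightarrow> nat" where "dec_nat n = n"
instance by standard (simp_all add: enc_nat_def dec_nat_def rec1_id)
end

instantiation bool :: coded
begin
definition enc_bool :: "bool \<Rightarrow> nat" where "enc_bool b = (if b then 1 else 0)"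
definition dec_bool :: "nat \<Rightarrow> bool" where "dec_bool n \<longleftrightarrow> n \<noteq> 0"
instance
proof
  have "(\<lambda>n. enc (dec n :: bool)) = (\<lambda>n. 1 - (1 - n))"
    by (auto simp: enc_bool_def dec_bool_def)
  then show "rec1 (\<lambda>n. enc (dec n :: bool))"
    by (simp only:) (intro rec1_diff rec1_const rec1_id)
qed (simp add: enc_bool_def dec_bool_def)
end

instantiation prod :: (coded, coded) coded
begin
definition enc_prod :: "'a \<times> 'b \<Rightarrow> nat" where
  "enc_prod p = prod_encode (enc (fst p), enc (snd p))"
definition dec_prod :: "nat \<Rightarrow> 'a \<times> 'b" where
  "dec_prod n = (dec (fst (prod_decode n)), dec (snd (prod_decode n)))"
instance
proof
  show "rec1 (\<lambda>n. enc (dec n :: 'a \<times> 'b))"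
    unfolding enc_prod_def dec_prod_def fst_conv snd_conv
    by (intro rec1_pair rec1_compose [OF rec1_enc_dec] rec1_fst rec1_snd)
qed (simp add: enc_prod_def dec_prod_def)
end

lemma computable_Pair [comp_intros]:
  "computable f \<Longrightarrow> computable g \<Longrightarrow> computable (\<lambda>x. (f x, g x))"
  unfolding computable_def enc_prod_def fst_conv snd_conv by (rule rec1_pair)

lemma computable_fst [comp_intros]:
  fixes f :: "'a::coded \<Rightarrow> 'b::coded \<times> 'c::coded"
  assumes "computable f" shows "computable (\<lambda>x. fst (f x))"
proof -
  have "rec1 (\<lambda>n. fst (prod_decode (enc (f (dec n)))))"
    using assms unfolding computable_def by (rule rec1_compose [OF rec1_fst])
  then show ?thesis by (simp add: computable_def enc_prod_def)
qed

lemma computable_snd [comp_intros]: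
  fixes f :: "'a::coded \<Rightarrow> 'b::coded \<times> 'c::coded"
  assumes "computable f" shows "computable (\<lambda>x. snd (f x))"
proof -
  have "rec1 (\<lambda>n. snd (prod_decode (enc (f (dec n)))))"
    using assms unfolding computable_def by (rule rec1_compose [OF rec1_snd])
  then show ?thesis by (simp add: computable_def enc_prod_def)
qed

lemma computable_compose2:
  assumes "computable (\<lambda>p. h (fst p) (snd p))" "computable f" "computable g"
  shows "computable (\<lambda>x. h (f x) (g x))"
  using computable_compose [OF assms(1) computable_Pair [OF assms(2,3)]] by simp

lemma computable_enc [comp_intros]:
  fixes f :: "'a::coded \<Rightarrow> 'b::coded"
  assumes "computable f" shows "computable (\<lambda>x. enc (f x))"
  using assms by (simp add: computable_def enc_nat_def)

lemma computable_dec [comp_intros]: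
  fixes f :: "'a::coded \<Rightarrow> nat"
  assumes "computable f" shows "computable (\<lambda>x. dec (f x) :: 'b::coded)"
  using rec1_compose [OF rec1_enc_dec [where 'a = 'b] assms [unfolded computable_def]]
  by (simp add: computable_def enc_nat_def)

lemma computable_rec1: "computable (f :: nat \<Rightarrow> nat) \<longleftrightarrow> rec1 f"
  by (simp add: computable_def enc_nat_def dec_nat_def)

lemma computable_Suc [comp_intros]: "computable f \<Longrightarrow> computable (\<lambda>x. Suc (f x))"
  by (simp add: computable_def enc_nat_def rec1_Suc)

lemma computable_add [comp_intros]:
  fixes f :: "'a::coded \<Rightarrow> nat" 
  shows "computable f \<Longrightarrow> computable g \<Longrightarrow> computable (\<lambda>x. f x + g x)"
  by (simp add: computable_def enc_nat_def rec1_add)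

lemma computable_diff [comp_intros]:
  fixes f :: "'a::coded \<Rightarrow> nat" 
  shows "computable f \<Longrightarrow> computable g \<Longrightarrow> computable (\<lambda>x. f x - g x)"
  by (simp add: computable_def enc_nat_def rec1_diff)

lemma computable_prod_encode [comp_intros]:
  "computable f \<Longrightarrow> computable (\<lambda>x. prod_encode (f x))"
  using computable_enc [of f] by (simp add: enc_prod_def enc_nat_def)

lemma computable_prod_decode [comp_intros]:
  "computable f \<Longrightarrow> computable (\<lambda>x. prod_decode (f x))"
  using computable_dec [of f, where 'b = "nat \<times> nat"] by (simp add: dec_prod_def dec_nat_def)

lemma computable_rec_nat [comp_intros]:
  fixes f :: "'a::coded \<Rightarrow> 'b::coded"
  assumes g: "computable (\<lambda>p. g (fst p) (fst (snd p)) (snd (snd p)))"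
    and f: "computable f" and N: "computable N"
  shows "computable (\<lambda>x. rec_nat (f x) (\<lambda>m r. g x m r) (N x))"
proof -
  define G where "G = (\<lambda>k. enc (let p = dec k in g (fst p) (fst (snd p)) (snd (snd p))))"
  have G: "rec1 G"
    using g by (simp add: computable_def G_def Let_def)
  have "rec1 (\<lambda>n. rec_nat (enc (f (dec n)))
      (\<lambda>m r. G (prod_encode (n, prod_encode (m, r)))) (enc (N (dec n))))" (is "rec1 ?R")
    by (rule rec1_rec_nat [OF N [unfolded computable_def] f [unfolded computable_def] G])
  moreover have "rec_nat (enc (f (dec n))) (\<lambda>m r. G (prod_encode (n, prod_encode (m, r)))) k
      = enc (rec_nat (f (dec n)) (\<lambda>m r. g (dec n) m r) k)" for n k
    by (induction k) (simp_all add: G_def dec_prod_def dec_nat_def)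
  ultimately show ?thesis
    by (simp add: computable_def enc_nat_def)
qed

lemma computable_if [comp_intros]:
  fixes f :: "'a::coded \<Rightarrow> 'b::coded"
  assumes "computable b" "computable f" "computable g"
  shows "computable (\<lambda>x. if b x then f x else g x)"
proof -
  have "computable (\<lambda>x. rec_nat (g x) (\<lambda>m r. f x) (enc (b x)))"
    by (intro comp_intros assms computable_compose [OF assms(2)])
  moreover have "rec_nat (g x) (\<lambda>m r. f x) (enc (b x)) = (if b x then f x else g x)" for x
    by (simp add: enc_bool_def)
  ultimately show ?thesis by simp
qed

lemma computable_not [comp_intros]:
  assumes "computable P" shows "computable (\<lambda>x. \<not> P x)"
proof -
  have "computable (\<lambda>x. if P x then False else True)" by (intro comp_intros assms)
  moreover have "(if P x then False else True) = (\<not> P x)" for x by simp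
  ultimately show ?thesis by (simp only:)
qed

lemma computable_conj [comp_intros]:
  assumes "computable P" "computable Q" shows "computable (\<lambda>x. P x \<and> Q x)"
proof -
  have "computable (\<lambda>x. if P x then Q x else False)" by (intro comp_intros assms)
  moreover have "(if P x then Q x else False) = (P x \<and> Q x)" for x by simp
  ultimately show ?thesis by (simp only:)
qed

lemma computable_disj [comp_intros]:
  assumes "computable P" "computable Q" shows "computable (\<lambda>x. P x \<or> Q x)"
proof -
  have "computable (\<lambda>x. \<not> (\<not> P x \<and> \<not> Q x))" by (intro comp_intros assms)
  then show ?thesis by simp
qed

lemma computable_imp [comp_intros]:
  assumes "computable P" "computable Q" shows "computable (\<lambda>x. P x \<longrightarrow> Q x)"
proof -
  have "computable (\<lambda>x. \<not> P x \<or> Q x)" by (intro comp_intros assms)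
  then show ?thesis by (simp only: imp_conv_disj)
qed

lemma computable_nonzero: "computable f \<Longrightarrow> computable (\<lambda>x. f x \<noteq> (0::nat))"
  using computable_dec [of f, where 'b = bool] by (simp add: dec_bool_def)

lemma computable_le [comp_intros]:
  assumes "computable f" "computable g" shows "computable (\<lambda>x. f x \<le> (g x :: nat))"
proof -
  have "computable (\<lambda>x. \<not> f x - g x \<noteq> 0)"
    by (intro computable_nonzero comp_intros assms)
  then show ?thesis by simp
qed

lemma computable_less [comp_intros]:
  assumes "computable f" "computable g" shows "computable (\<lambda>x. f x < (g x :: nat))"
  using computable_not [OF computable_le [OF assms(2,1)]] by (simp add: not_le)

lemma computable_eq [comp_intros]:
  fixes f g :: "'a::coded \<Rightarrow> 'b::coded"
  assumes "computable f" "computable g" shows "computable (\<lambda>x. f x = g x)"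
proof -
  have "computable (\<lambda>x. enc (f x) \<le> enc (g x) \<and> enc (g x) \<le> enc (f x))"
    by (intro comp_intros assms)
  then show ?thesis by (simp add: eq_iff [symmetric])
qed

lemma computable_funpow [comp_intros]:
  fixes f :: "'a::coded \<Rightarrow> 'b::coded \<Rightarrow> 'b"
  assumes "computable (\<lambda>p. f (fst p) (snd p))" "computable a" "computable N"
  shows "computable (\<lambda>x. (f x ^^ N x) (a x))"
proof -
  have "computable (\<lambda>x. rec_nat (a x) (\<lambda>m r. f x r) (N x))"
    by (intro comp_intros assms computable_compose2 [OF assms(1)])
  moreover have "rec_nat (a x) (\<lambda>m r. f x r) n = (f x ^^ n) (a x)" for x n
    by (induction n) auto
  ultimately show ?thesis by simp
qed

lemma computable_mult [comp_intros]:
  assumes "computable f" "computable g" shows "computable (\<lambda>x. f x * (g x :: nat))"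
proof -
  have "computable (\<lambda>x. ((\<lambda>r. g x + r) ^^ f x) 0)"
    by (intro comp_intros assms computable_compose [OF assms(2)])
  moreover have "((\<lambda>r. b + r) ^^ a) 0 = a * b" for a b :: nat
    by (induction a) auto
  ultimately show ?thesis by simp
qed

text \<open>
  Effective choice by unbounded search. All later algorithms that look for a
  witness go through this lemma.
\<close>
lemma computable_choice:
  fixes P :: "'a::coded \<Rightarrow> 'b::coded \<Rightarrow> bool"
  assumes P: "computable (\<lambda>p. P (fst p) (snd p))" and ex: "\<And>x. \<exists>y. P x y"
  shows "\<exists>f. computable f \<and> (\<forall>x. P x (f x))"
proof (intro exI conjI allI)
  define F where "F = (\<lambda>k. enc (let p = dec k in \<not> P (fst p) (snd p)))"
  have F: "rec1 F"
    using computable_not [OF P] by (simp add: computable_def F_def Let_def)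
  have F0: "F (prod_encode (n, m)) = 0 \<longleftrightarrow> P (dec n) (dec m)" for n m
    by (simp add: F_def dec_prod_def enc_bool_def)
  have "\<exists>m. P (dec n) (dec m)" for n
  proof -
    obtain y where "P (dec n) y" using ex by blast
    then have "P (dec n) (dec (enc y))" by simp
    then show ?thesis ..
  qed
  then have "rec1 (\<lambda>n. LEAST m. P (dec n) (dec m))"
    using rec1_Least [OF F] unfolding F0 by blast
  from rec1_compose [OF rec1_enc_dec this]
  show "computable (\<lambda>x. dec (LEAST m. P x (dec m)) :: 'b)"
    by (simp add: computable_def)
  show "P x (dec (LEAST m. P x (dec m)))" for x
  proof -
    obtain y where "P x y" using ex by blast
    then have "P x (dec (enc y))" by simp
    then show ?thesis by (rule LeastI)
  qed
qed

lemma computable_inv: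
  fixes f :: "'a::coded \<Rightarrow> 'b::coded"
  assumes "computable f" "bij f" shows "computable (inv_into UNIV f)"
proof -
  have "\<exists>x. f x = y" for y
    using bij_is_surj [OF assms(2)] by (metis surjD)
  moreover have "computable (\<lambda>p. f (snd p) = fst p)"
    by (intro comp_intros computable_compose [OF assms(1)])
  ultimately obtain g where g: "computable g" "\<And>y. f (g y) = y"
    using computable_choice [of "\<lambda>y x. f x = y"] by auto
  have "inv_into UNIV f y = g y" for y
    using g(2) bij_is_inj [OF assms(2)] by (simp add: inv_f_eq)
  then have "inv_into UNIV f = g" ..
  with g(1) show ?thesis by simp
qed

section \<open>Computable list operations\<close>

text \<open>
  A coded list has at most as many entries as its code, hence iterating a single step as many
  times as the code says runs through the whole list; once the list is empty, further steps do nothing.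
\<close>
lemma fold_list_decode_funpow:
  "fold f (list_decode n) a =
    snd (((\<lambda>(c, r). if c = 0 then (c, r) else
            (snd (prod_decode (c - 1)), f (fst (prod_decode (c - 1))) r)) ^^ n) (n, a))"
    (is "_ = snd ((?s ^^ n) (n, a))")
proof -
  have fix0: "(?s ^^ k) (0, r) = (0, r)" for k r
    by (induction k) (auto simp: funpow_swap1)
  have "snd ((?s ^^ k) (n, a)) = fold f (list_decode n) a" if "n \<le> k" for k
    using that
  proof (induction n arbitrary: a k rule: less_induct)
    case (less n)
    show ?case
    proof (cases n)
      case 0
      then show ?thesis by (simp only: fix0) simp
    next
      case (Suc m)
      then obtain k' where k: "k = Suc k'" using less.prems by (cases k) auto
      have "snd (prod_decode m) \<le> m"
        using le_prod_encode_2 [of "snd (prod_decode m)" "fst (prod_decode m)"] by simp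
      then have "snd ((?s ^^ k') (snd (prod_decode m), f (fst (prod_decode m)) a)) =
          fold f (list_decode (snd (prod_decode m))) (f (fst (prod_decode m)) a)"
        using less.prems Suc k by (intro less.IH) auto
      then show ?thesis
        by (simp add: Suc k funpow_swap1 split: prod.split)
    qed
  qed
  then show ?thesis by simp
qed

lemma computable_fold_list_decode:
  fixes f :: "'a::coded \<Rightarrow> nat \<Rightarrow> 'b::coded \<Rightarrow> 'b"
  assumes f: "computable (\<lambda>p. f (fst p) (fst (snd p)) (snd (snd p)))"
    and "computable l" "computable a"
  shows "computable (\<lambda>x. fold (f x) (list_decode (l x)) (a x))"
proof -
  have f': "computable (\<lambda>x. f (u x) (v x) (w x))"
    if "computable u" "computable v" "computable w" for u :: "'c::coded \<Rightarrow> 'a" and v w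
    using computable_compose [OF f, of "\<lambda>x. (u x, v x, w x)"] that by (simp add: comp_intros)
  have *: "computable (\<lambda>x. snd (((\<lambda>p. if fst p = 0 then (fst p, snd p) else
            (snd (prod_decode (fst p - 1)), f x (fst (prod_decode (fst p - 1))) (snd p))) ^^ l x) (l x, a x)))"
    by (intro comp_intros assms f' computable_compose [OF assms(2)])
  show ?thesis
    using * by (simp only: fold_list_decode_funpow case_prod_beta')
qed

lemma rev_eq_fold_Cons: "rev xs = fold (#) xs []"
  by (simp add: fold_Cons_rev)

text \<open>
  Mapping over a list is needed before lists are known to be a coded type, in order to
  normalise list codes. A fold produces the list in reverse order, so it is applied twice.
\<close>
lemma computable_list_rev_map_code:
  assumes "computable h"
  shows "computable (\<lambda>n. list_encode (rev (map h (list_decode n))))"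
proof -
  have "computable (\<lambda>n. fold (\<lambda>k c. Suc (prod_encode (h k, c))) (list_decode n) 0)"
    by (intro comp_intros computable_fold_list_decode computable_compose [OF assms])
  moreover have "fold (\<lambda>k c. Suc (prod_encode (h k, c))) xs (list_encode ys)
      = list_encode (rev (map h xs) @ ys)" for xs ys
    by (induction xs arbitrary: ys) (simp_all flip: list_encode.simps)
  from this [of _ "[]"] have
    "fold (\<lambda>k c. Suc (prod_encode (h k, c))) xs 0 = list_encode (rev (map h xs))" for xs
    by simp
  ultimately show ?thesis by simp
qed

instantiation list :: (coded) coded
begin
definition enc_list :: "'a list \<Rightarrow> nat" where "enc_list xs = list_encode (map enc xs)"
definition dec_list :: "nat \<Rightarrow> 'a list" where "dec_list n = map dec (list_decode n)"
instance
proof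
  have "computable (\<lambda>n. list_encode (rev (map (\<lambda>k. k) (list_decode
          (list_encode (rev (map (\<lambda>k. enc (dec k :: 'a)) (list_decode n))))))))"
    by (rule computable_compose [OF computable_list_rev_map_code computable_list_rev_map_code])
       (intro comp_intros)+
  then show "rec1 (\<lambda>n. enc (dec n :: 'a list))"
    by (simp add: enc_list_def dec_list_def comp_def rev_map [symmetric] flip: computable_rec1)
qed (simp add: enc_list_def dec_list_def comp_def)
end

lemma computable_fold [comp_intros]:
  fixes f :: "'a::coded \<Rightarrow> 'c::coded \<Rightarrow> 'b::coded \<Rightarrow> 'b"
  assumes f: "computable (\<lambda>p. f (fst p) (fst (snd p)) (snd (snd p)))"
    and "computable l" "computable a"
  shows "computable (\<lambda>x. fold (\<lambda>y r. f x y r) (l x) (a x))"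
proof -
  have f': "computable (\<lambda>x. f (u x) (v x) (w x))"
    if "computable u" "computable v" "computable w" for u :: "'d::coded \<Rightarrow> 'a" and v w
    using computable_compose [OF f, of "\<lambda>x. (u x, v x, w x)"] that by (simp add: comp_intros)
  have "computable (\<lambda>x. fold (\<lambda>k r. f x (dec k) r) (list_decode (enc (l x))) (a x))"
    by (intro computable_fold_list_decode comp_intros assms f')
  then show ?thesis
    by (simp add: enc_list_def fold_map comp_def)
qed

lemma computable_Cons [comp_intros]:
  fixes f :: "'a::coded \<Rightarrow> 'b::coded"
  assumes "computable f" "computable l" shows "computable (\<lambda>x. f x # l x)"
proof -
  have "computable (\<lambda>x. dec (Suc (prod_encode (enc (f x), enc (l x)))) :: 'b list)"
    by (intro comp_intros assms)
  then show ?thesis by (simp add: dec_list_def enc_list_def comp_def)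
qed

lemma computable_rev [comp_intros]: "computable l \<Longrightarrow> computable (\<lambda>x. rev (l x))"
  unfolding rev_eq_fold_Cons by (intro comp_intros)

lemma computable_foldr [comp_intros]:
  fixes f :: "'a::coded \<Rightarrow> 'c::coded \<Rightarrow> 'b::coded \<Rightarrow> 'b"
  assumes f: "computable (\<lambda>p. f (fst p) (fst (snd p)) (snd (snd p)))"
    and "computable l" "computable a"
  shows "computable (\<lambda>x. foldr (\<lambda>y r. f x y r) (l x) (a x))"
  unfolding foldr_conv_fold by (intro comp_intros assms)

lemma computable_append [comp_intros]:
  assumes "computable k" "computable l" shows "computable (\<lambda>x. k x @ l x)"
proof -
  have "computable (\<lambda>x. foldr (\<lambda>y r. y # r) (k x) (l x))" by (intro comp_intros assms)
  moreover have "foldr (\<lambda>y r. y # r) xs ys = xs @ ys" for xs ys :: "'b list"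
    by (induction xs) auto
  ultimately show ?thesis by simp
qed

lemma computable_map [comp_intros]:
  fixes f :: "'a::coded \<Rightarrow> 'c::coded \<Rightarrow> 'b::coded"
  assumes f: "computable (\<lambda>p. f (fst p) (snd p))" and "computable l"
  shows "computable (\<lambda>x. map (\<lambda>y. f x y) (l x))"
proof -
  have "computable (\<lambda>x. foldr (\<lambda>y r. f x y # r) (l x) [])"
    by (intro comp_intros assms computable_compose2 [OF f])
  moreover have "foldr (\<lambda>y r. f x y # r) xs [] = map (f x) xs" for x xs
    by (induction xs) auto
  ultimately show ?thesis by simp
qed

lemma computable_filter [comp_intros]:
  fixes P :: "'a::coded \<Rightarrow> 'c::coded \<Rightarrow> bool"
  assumes P: "computable (\<lambda>p. P (fst p) (snd p))" and "computable l"
  shows "computable (\<lambda>x. filter (\<lambda>y. P x y) (l x))"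
proof -
  have "computable (\<lambda>x. foldr (\<lambda>y r. if P x y then y # r else r) (l x) [])"
    by (intro comp_intros assms computable_compose2 [OF P])
  moreover have "foldr (\<lambda>y r. if P x y then y # r else r) xs [] = filter (P x) xs" for x xs
    by (induction xs) auto
  ultimately show ?thesis by simp
qed

lemma computable_ball_set [comp_intros]:
  fixes P :: "'a::coded \<Rightarrow> 'c::coded \<Rightarrow> bool"
  assumes P: "computable (\<lambda>p. P (fst p) (snd p))" and "computable l"
  shows "computable (\<lambda>x. \<forall>y\<in>set (l x). P x y)"
proof -
  have "computable (\<lambda>x. foldr (\<lambda>y r. P x y \<and> r) (l x) True)"
    by (intro comp_intros assms computable_compose2 [OF P])
  moreover have "foldr (\<lambda>y r. P x y \<and> r) xs True \<longleftrightarrow> (\<forall>y\<in>set xs. P x y)" for x xs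
    by (induction xs) auto
  ultimately show ?thesis by simp
qed

lemma computable_bex_set [comp_intros]:
  fixes P :: "'a::coded \<Rightarrow> 'c::coded \<Rightarrow> bool"
  assumes P: "computable (\<lambda>p. P (fst p) (snd p))" and "computable l"
  shows "computable (\<lambda>x. \<exists>y\<in>set (l x). P x y)"
proof -
  have "computable (\<lambda>x. \<not> (\<forall>y\<in>set (l x). \<not> P x y))"
    by (intro comp_intros assms)
  then show ?thesis by simp
qed

lemma computable_member [comp_intros]:
  assumes "computable f" "computable l" shows "computable (\<lambda>x. f x \<in> set (l x))"
proof -
  have "computable (\<lambda>x. \<exists>y\<in>set (l x). f x = y)"
    by (intro comp_intros assms computable_compose [OF assms(1)])
  then show ?thesis by simp
qed

lemma computable_concat [comp_intros]:
  assumes "computable l" shows "computable (\<lambda>x. concat (l x))"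
proof -
  have "computable (\<lambda>x. foldr (\<lambda>y r. y @ r) (l x) [])" by (intro comp_intros assms)
  moreover have "foldr (\<lambda>y r. y @ r) xs [] = concat xs" for xs :: "'b list list"
    by (induction xs) auto
  ultimately show ?thesis by simp
qed

lemma computable_hd [comp_intros]:
  assumes "computable l" shows "computable (\<lambda>x. hd (l x))"
proof -
  have "computable (\<lambda>x. foldr (\<lambda>y r. y) (l x) (hd []))" by (intro comp_intros assms)
  moreover have "foldr (\<lambda>y r. y) xs (hd []) = hd xs" for xs :: "'b list"
    by (cases xs) auto
  ultimately show ?thesis by simp
qed

lemma computable_tl [comp_intros]:
  assumes "computable l" shows "computable (\<lambda>x. tl (l x))"
proof -
  have "computable (\<lambda>x. snd (foldr (\<lambda>y r. (y # fst r, fst r)) (l x) ([], [])))"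
    by (intro comp_intros assms)
  moreover have "foldr (\<lambda>y r. (y # fst r, fst r)) xs ([], []) = (xs, tl xs)" for xs :: "'b list"
    by (induction xs) auto
  ultimately show ?thesis by simp
qed

lemma computable_drop [comp_intros]:
  assumes "computable n" "computable l" shows "computable (\<lambda>x. drop (n x) (l x))"
proof -
  have "computable (\<lambda>x. (tl ^^ n x) (l x))" by (intro comp_intros assms)
  moreover have "(tl ^^ k) xs = drop k xs" for k and xs :: "'b list"
    by (induction k) (auto simp: drop_Suc tl_drop)
  ultimately show ?thesis by simp
qed

lemma computable_upt [comp_intros]:
  assumes "computable n" shows "computable (\<lambda>x. [0..<n x])"
proof -
  have "computable (\<lambda>x. rec_nat [] (\<lambda>m r. r @ [m]) (n x))" by (intro comp_intros assms)
  moreover have "rec_nat [] (\<lambda>m r. r @ [m]) k = [0..<k]" for k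
    by (induction k) auto
  ultimately show ?thesis by simp
qed

lemma computable_distinct [comp_intros]:
  assumes "computable l" shows "computable (\<lambda>x. distinct (l x))"
proof -
  have "computable (\<lambda>x. snd (foldr (\<lambda>y r. (y # fst r, snd r \<and> y \<notin> set (fst r))) (l x) ([], True)))"
    by (intro comp_intros assms)
  moreover have "foldr (\<lambda>y r. (y # fst r, snd r \<and> y \<notin> set (fst r))) xs ([], True) = (xs, distinct xs)"
    for xs :: "'b list"
    by (induction xs) auto
  ultimately show ?thesis by simp
qed

lemma computable_successively [comp_intros]:
  fixes P :: "'a::coded \<Rightarrow> 'c::coded \<Rightarrow> 'c \<Rightarrow> bool"
  assumes P: "computable (\<lambda>p. P (fst p) (fst (snd p)) (snd (snd p)))" and "computable l"
  shows "computable (\<lambda>x. successively (P x) (l x))"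
proof -
  have P': "computable (\<lambda>x. P (u x) (v x) (w x))"
    if "computable u" "computable v" "computable w" for u :: "'d::coded \<Rightarrow> 'a" and v w
    using computable_compose [OF P, of "\<lambda>x. (u x, v x, w x)"] that by (simp add: comp_intros)
  have "computable (\<lambda>x. snd (foldr (\<lambda>y r. (y # fst r, fst r = [] \<or> P x y (hd (fst r)) \<and> snd r)) (l x) ([], True)))"
    by (intro comp_intros assms P')
  moreover have "foldr (\<lambda>y r. (y # fst r, fst r = [] \<or> P x y (hd (fst r)) \<and> snd r)) xs ([], True)
      = (xs, successively (P x) xs)" for x xs
    by (induction xs) (auto simp: successively_Cons)
  ultimately show ?thesis by simp
qed

section \<open>Components and Hamiltonian paths in locally finite graphs\<close>

text \<open>
  Reachability by a path that stays in \<open>A\<close>. Edge relations are reflexive throughout, so that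
  \<open>E ^^ n\<close> means distance at most \<open>n\<close>.
\<close>
definition joined :: "('v \<times> 'v) set \<Rightarrow> 'v set \<Rightarrow> ('v \<times> 'v) set" where
  "joined E A = rtrancl (E \<inter> A \<times> A)"

definition connected_in :: "('v \<times> 'v) set \<Rightarrow> 'v set \<Rightarrow> bool" where
  "connected_in E A \<longleftrightarrow> (\<forall>x\<in>A. \<forall>y\<in>A. (x, y) \<in> joined E A)"

definition component :: "('v \<times> 'v) set \<Rightarrow> 'v set \<Rightarrow> 'v \<Rightarrow> 'v set" where
  "component E A x = joined E A `` {x}"

lemma joined_refl [simp]: "(x, x) \<in> joined E A"
  by (simp add: joined_def)

lemma joined_trans: "(x, y) \<in> joined E A \<Longrightarrow> (y, z) \<in> joined E A \<Longrightarrow> (x, z) \<in> joined E A"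
  unfolding joined_def by (rule rtrancl_trans)

lemma joined_edge: "(x, y) \<in> E \<Longrightarrow> x \<in> A \<Longrightarrow> y \<in> A \<Longrightarrow> (x, y) \<in> joined E A"
  unfolding joined_def by (intro r_into_rtrancl) auto

lemma joined_mono: "A \<subseteq> B \<Longrightarrow> (x, y) \<in> joined E A \<Longrightarrow> (x, y) \<in> joined E B"
  unfolding joined_def by (erule rtrancl_mono [THEN subsetD, rotated]) auto

lemma joined_UNIV: "joined E UNIV = rtrancl E"
  by (simp add: joined_def)

lemma joined_in: "(x, y) \<in> joined E A \<Longrightarrow> x \<in> A \<Longrightarrow> y \<in> A"
  unfolding joined_def by (induction rule: rtrancl_induct) auto

text \<open>
  A path that leaves \<open>A\<close> has a first edge out of \<open>A\<close>. Most geometric arguments below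
  apply this fact, with \<open>B\<close> as the set in which the whole path lies.
\<close>
lemma joined_exit:
  assumes "(x, y) \<in> joined E B" "x \<in> A" "x \<in> B" "y \<notin> A"
  shows "\<exists>a b. (x, a) \<in> joined E (A \<inter> B) \<and> a \<in> A \<and> a \<in> B \<and> b \<in> B \<and> b \<notin> A \<and> (a, b) \<in> E"
proof -
  have "y \<in> A \<and> (x, y) \<in> joined E (A \<inter> B) \<or>
      (\<exists>a b. (x, a) \<in> joined E (A \<inter> B) \<and> a \<in> A \<and> a \<in> B \<and> b \<in> B \<and> b \<notin> A \<and> (a, b) \<in> E)"
    using assms(1) unfolding joined_def
  proof (induction rule: rtrancl_induct)
    case base
    then show ?case using assms(2) by simp
  next
    case (step y z)
    show ?case
    proof (cases "y \<in> A \<and> (x, y) \<in> joined E (A \<inter> B)")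
      case True
      show ?thesis
      proof (cases "z \<in> A")
        case True
        then have "(x, z) \<in> joined E (A \<inter> B)"
          using \<open>y \<in> A \<and> _\<close> step.hyps(2) joined_edge [of y z E "A \<inter> B"] joined_trans by fastforce
        with True show ?thesis unfolding joined_def by blast
      next
        case False
        with \<open>y \<in> A \<and> _\<close> step.hyps(2) show ?thesis unfolding joined_def by blast
      qed
    next
      case False
      with step.IH show ?thesis unfolding joined_def by blast
    qed
  qed
  with assms(4) show ?thesis by blast
qed

lemma component_self [simp]: "x \<in> component E A x"
  by (simp add: component_def)

lemma component_subset: "x \<in> A \<Longrightarrow> component E A x \<subseteq> A"
  using joined_in [of x _ E A] by (auto simp: component_def)

lemma component_mono: "A \<subseteq> B \<Longrightarrow> component E A x \<subseteq> component E B x"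
  using joined_mono [of A B x _ E] by (auto simp: component_def)

lemma component_closed:
  assumes "y \<in> component E A x" "x \<in> A" "z \<in> A" "(y, z) \<in> E"
  shows "z \<in> component E A x"
  using assms component_subset [of x A E] joined_edge [of y z E A] joined_trans [of x y E A z]
  by (auto simp: component_def)

lemma connected_in_subset_component:
  assumes "connected_in E B" "B \<subseteq> A" "x \<in> B" shows "B \<subseteq> component E A x"
  using assms joined_mono [OF assms(2)] unfolding connected_in_def component_def by blast

locale graph =
  fixes E :: "('v \<times> 'v) set"
  assumes refl: "(x, x) \<in> E"
    and sym: "(x, y) \<in> E \<Longrightarrow> (y, x) \<in> E"
    and locally_finite: "finite (E `` {x})"
    and connected: "(x, y) \<in> rtrancl E"
begin

abbreviation "conn \<equiv> connected_in E"
abbreviation "cmp \<equiv> component E"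

lemma joined_sym: "(x, y) \<in> joined E A \<Longrightarrow> (y, x) \<in> joined E A"
  unfolding joined_def
  by (rule symD [OF sym_rtrancl]) (auto simp: sym_def intro: sym)

lemma component_eq: "y \<in> cmp A x \<Longrightarrow> cmp A y = cmp A x"
  using joined_sym [of x y A] joined_trans by (auto simp: component_def)

lemma conn_star:
  assumes "\<And>x. x \<in> A \<Longrightarrow> (x, a) \<in> joined E A" shows "conn A"
  unfolding connected_in_def
proof (intro ballI)
  fix x y assume "x \<in> A" "y \<in> A"
  show "(x, y) \<in> joined E A"
    by (rule joined_trans [OF assms joined_sym [OF assms]]) fact+
qed

lemma conn_component: "conn (cmp A x)"
proof -
  have *: "(x, y) \<in> joined E (cmp A x)" if "(x, y) \<in> joined E A" for y
    using that unfolding joined_def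
  proof (induction rule: rtrancl_induct)
    case (step y z)
    then have "y \<in> cmp A x" "z \<in> cmp A x" "(y, z) \<in> E"
      by (auto simp: component_def joined_def intro: rtrancl.rtrancl_into_rtrancl)
    then have "(y, z) \<in> joined E (cmp A x)" by (intro joined_edge)
    with step.IH show ?case unfolding joined_def by (rule rtrancl_trans)
  qed simp
  show ?thesis
  proof (rule conn_star)
    fix y assume "y \<in> cmp A x"
    then have "(x, y) \<in> joined E A" by (simp add: component_def)
    then show "(y, x) \<in> joined E (cmp A x)" by (rule joined_sym [OF *])
  qed
qed

lemma conn_Un:
  assumes "conn A" "conn B" "a \<in> A" "b \<in> B" "(a, b) \<in> E" shows "conn (A \<union> B)"
proof -
  have *: "(a, x) \<in> joined E (A \<union> B)" if "x \<in> A \<union> B" for x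
    using that
  proof
    assume "x \<in> A"
    then show ?thesis using assms joined_mono [of A "A \<union> B" a x] by (auto simp: connected_in_def)
  next
    assume "x \<in> B"
    then have "(b, x) \<in> joined E (A \<union> B)"
      using assms joined_mono [of B "A \<union> B" b x] by (auto simp: connected_in_def)
    moreover have "(a, b) \<in> joined E (A \<union> B)"
      using assms by (intro joined_edge) auto
    ultimately show ?thesis using joined_trans by metis
  qed
  show ?thesis by (rule conn_star, rule joined_sym, rule *)
qed

lemma conn_singleton: "conn {x}"
  by (simp add: connected_in_def)

lemma finite_conn_path:
  assumes "(x, y) \<in> joined E A" "x \<in> A"
  obtains F where "finite F" "F \<subseteq> A" "conn F" "x \<in> F" "y \<in> F"
proof -
  have "\<exists>F. finite F \<and> F \<subseteq> A \<and> conn F \<and> x \<in> F \<and> y \<in> F"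
    using assms(1) unfolding joined_def
  proof (induction rule: rtrancl_induct)
    case base
    then show ?case using assms(2) conn_singleton by (intro exI [of _ "{x}"]) auto
  next
    case (step y z)
    then obtain F where "finite F \<and> F \<subseteq> A \<and> conn F \<and> x \<in> F \<and> y \<in> F" by blast
    then show ?case
      using step.hyps conn_Un [of F "{z}" y z] conn_singleton by (intro exI [of _ "F \<union> {z}"]) auto
  qed
  with that show thesis by blast
qed

lemma finite_conn_superset:
  assumes "finite B" "B \<subseteq> A" "conn A" "a \<in> A"
  obtains F where "finite F" "F \<subseteq> A" "conn F" "insert a B \<subseteq> F"
proof -
  have "\<exists>F. finite F \<and> F \<subseteq> A \<and> conn F \<and> insert a B \<subseteq> F"
    using assms(1,2)
  proof (induction rule: finite_induct)
    case empty
    then show ?case using assms(4) conn_singleton by (intro exI [of _ "{a}"]) auto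
  next
    case (insert b B)
    then obtain F where F: "finite F" "F \<subseteq> A" "conn F" "insert a B \<subseteq> F" by auto
    have "(a, b) \<in> joined E A" using assms(3,4) insert.prems by (auto simp: connected_in_def)
    then obtain F' where F': "finite F'" "F' \<subseteq> A" "conn F'" "a \<in> F'" "b \<in> F'"
      using finite_conn_path assms(4) by metis
    have "conn (F \<union> F')" using conn_Un [OF F(3) F'(3), of a a] F(4) F'(4) refl by auto
    then show ?case using F F' by (intro exI [of _ "F \<union> F'"]) auto
  qed
  with that show thesis by blast
qed

lemma conn_UNIV: "conn UNIV"
  by (simp add: connected_in_def joined_UNIV connected)

text \<open>
  Since the graph is connected, every component of the complement of \<open>K\<close> touches \<open>K\<close>. This is why
  a finite set has only finitely many complementary components.
\<close>
lemma component_boundary: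
  assumes "x \<notin> K" "K \<noteq> {}"
  obtains a b where "a \<in> cmp (- K) x" "b \<in> K" "(a, b) \<in> E"
proof -
  obtain k where "k \<in> K" using assms(2) by blast
  have "(x, k) \<in> joined E UNIV" by (simp add: joined_UNIV connected)
  moreover have "k \<notin> cmp (- K) x" using \<open>k \<in> K\<close> component_subset [of x "- K" E] assms(1) by auto
  ultimately obtain a b where ab: "a \<in> cmp (- K) x" "b \<notin> cmp (- K) x" "(a, b) \<in> E"
    using joined_exit [of x k E UNIV "cmp (- K) x"] by auto
  moreover from this have "b \<in> K" using component_closed [of a E "- K" x b] assms(1) by auto
  ultimately show thesis using that by blast
qed

lemma finite_boundary: "finite K \<Longrightarrow> finite (E `` K)"
  using locally_finite by (subst Image_eq_UN) auto

lemma finite_components: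
  assumes "finite K" "K \<noteq> {}" shows "finite (cmp (- K) ` (- K))"
proof (rule finite_subset)
  show "cmp (- K) ` (- K) \<subseteq> cmp (- K) ` (E `` K)"
  proof
    fix C assume "C \<in> cmp (- K) ` (- K)"
    then obtain x where x: "x \<notin> K" "C = cmp (- K) x" by auto
    then obtain a b where "a \<in> cmp (- K) x" "b \<in> K" "(a, b) \<in> E"
      using component_boundary assms(2) by metis
    then show "C \<in> cmp (- K) ` (E `` K)"
      using x component_eq sym by blast
  qed
qed (simp add: finite_boundary assms)

lemma infinite_component_in:
  assumes "finite K" "K \<noteq> {}" "infinite X" "X \<subseteq> - K"
  obtains x where "x \<in> X" "infinite (cmp (- K) x)"
proof -
  have "finite (\<Union>x\<in>X. cmp (- K) x)" if "\<And>x. x \<in> X \<Longrightarrow> finite (cmp (- K) x)"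
  proof (rule finite_Union)
    show "finite (cmp (- K) ` X)"
      by (rule finite_subset [OF _ finite_components [OF assms(1,2)]]) (use assms(4) in blast)
  qed (use that in blast)
  moreover have "X \<subseteq> (\<Union>x\<in>X. cmp (- K) x)"
    by (intro subsetI) (rule UN_I, assumption, rule component_self)
  ultimately show thesis using that assms(3) infinite_super by blast
qed

definition one_ended :: bool where
  "one_ended \<longleftrightarrow> (\<forall>K x y. finite K \<longrightarrow> x \<notin> K \<longrightarrow> y \<notin> K \<longrightarrow> infinite (cmp (- K) x) \<longrightarrow>
     infinite (cmp (- K) y) \<longrightarrow> cmp (- K) x = cmp (- K) y)"

text \<open>
  \<open>F\<close> consists of a path from \<open>v\<close> to \<open>w\<close> outside \<open>P\<close> together with the finite components
  of the complement of \<open>P\<close> and this path. The rest is a union of infinite components, so with one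
  end it is a single component. Each component swallowed is attached to the path, because the
  complement of \<open>P\<close> was connected.
\<close>
lemma one_ended_fill:
  assumes one: one_ended and inf: "infinite (UNIV :: 'v set)"
    and P: "finite P" "conn (- P)" and v: "v \<notin> P" and w: "w \<notin> P"
  obtains F z b where "finite F" "F \<inter> P = {}" "conn F" "v \<in> F" "w \<in> F"
    "conn (- (P \<union> F))" "z \<in> F" "b \<notin> P \<union> F" "(z, b) \<in> E"
proof -
  have "(v, w) \<in> joined E (- P)" using P(2) v w by (simp add: connected_in_def)
  then obtain F0 where F0: "finite F0" "F0 \<subseteq> - P" "conn F0" "v \<in> F0" "w \<in> F0"
    using finite_conn_path [of v w "- P"] v by auto
  \<comment> \<open>The components to be filled in are those of the complement of \<open>P\<close> and the path \<open>F0\<close>.\<close>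
  define K where "K = P \<union> F0"
  have K: "finite K" "K \<noteq> {}" using P F0 by (auto simp: K_def)
  define H where "H = {x. x \<notin> K \<and> finite (cmp (- K) x)}"
  define F where "F = F0 \<union> H"
  have H_eq: "H = (\<Union>C\<in>{C \<in> cmp (- K) ` (- K). finite C}. C)" (is "_ = ?U")
  proof
    show "H \<subseteq> ?U"
    proof
      fix y assume "y \<in> H"
      then show "y \<in> ?U"
        using component_self [of y E "- K"] by (intro UN_I [of "cmp (- K) y"]) (auto simp: H_def)
    qed
    show "?U \<subseteq> H"
    proof
      fix y assume "y \<in> ?U"
      then obtain x where x: "x \<notin> K" "finite (cmp (- K) x)" "y \<in> cmp (- K) x" by auto
      then show "y \<in> H" using component_subset [of x "- K" E] component_eq [of y "- K" x]
        by (auto simp: H_def)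
    qed
  qed
  have "finite H"
    unfolding H_eq by (rule finite_UN_I) (use finite_components [OF K] in auto)
  then have finF: "finite F" using F0 by (simp add: F_def)
  have disj: "F \<inter> P = {}" using F0 by (auto simp: F_def H_def K_def)
  have F_conn: "conn F"
  proof -
    have "(x, v) \<in> joined E F" if x: "x \<in> F" for x
    proof (cases "x \<in> F0")
      case True
      then show ?thesis
        using F0 joined_mono [of F0 F x v] by (auto simp: connected_in_def F_def)
    next
      case False
      then have xH: "x \<in> H" using x by (simp add: F_def)
      then have xK: "x \<notin> K" and xP: "x \<in> - P" by (auto simp: H_def K_def)
      have "(x, v) \<in> joined E (- P)" using P(2) xP v by (simp add: connected_in_def)
      moreover have "v \<notin> cmp (- K) x"
        using component_subset [of x "- K" E] xK F0(4) by (auto simp: K_def)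
      ultimately obtain a b where ab: "a \<in> cmp (- K) x" "b \<notin> cmp (- K) x" "b \<notin> P" "(a, b) \<in> E"
        using joined_exit [of x v E "- P" "cmp (- K) x"] xP by auto
      have "b \<in> F0" using component_closed [of a E "- K" x b] ab xK by (auto simp: K_def)
      have sub: "cmp (- K) x \<subseteq> F" using xH H_eq xK by (auto simp: F_def H_def)
      have "(x, a) \<in> joined E F"
        using conn_component [of "- K" x] ab(1) joined_mono [OF sub] by (simp add: connected_in_def)
      moreover have "(a, b) \<in> joined E F"
        using sub ab \<open>b \<in> F0\<close> by (intro joined_edge) (auto simp: F_def)
      moreover have "(b, v) \<in> joined E F"
        using F0 \<open>b \<in> F0\<close> joined_mono [of F0 F b v] by (auto simp: connected_in_def F_def)
      ultimately show ?thesis using joined_trans by metis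
    qed
    then show ?thesis by (rule conn_star)
  qed
  have out: "x \<notin> K \<and> infinite (cmp (- K) x)" if "x \<notin> P \<union> F" for x
    using that by (auto simp: F_def H_def K_def)
  have out_conn: "conn (- (P \<union> F))"
    unfolding connected_in_def
  proof (intro ballI)
    fix x y assume "x \<in> - (P \<union> F)" "y \<in> - (P \<union> F)"
    then have *: "x \<notin> K" "y \<notin> K" "infinite (cmp (- K) x)" "infinite (cmp (- K) y)"
      using out by auto
    then have eq: "cmp (- K) x = cmp (- K) y"
      using one K(1) unfolding one_ended_def by blast
    have "cmp (- K) x \<subseteq> - (P \<union> F)"
    proof
      fix u assume u: "u \<in> cmp (- K) x"
      then have "u \<notin> K" using component_subset [of x "- K" E] * by auto
      then show "u \<in> - (P \<union> F)"
        using u * component_eq [of u "- K" x] by (auto simp: F_def H_def K_def)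
    qed
    moreover have "(x, y) \<in> joined E (cmp (- K) x)"
      using conn_component [of "- K" x] component_self [of y E "- K"] component_self [of x E "- K"]
      unfolding connected_in_def eq by blast
    ultimately show "(x, y) \<in> joined E (- (P \<union> F))" by (rule joined_mono)
  qed
  have "\<exists>u. u \<notin> P \<union> F"
    using inf finF P(1) by (metis UNIV_eq_I finite_Un)
  then obtain u where u: "u \<notin> P \<union> F" by blast
  have "(v, u) \<in> joined E (- P)" using P(2) v u by (simp add: connected_in_def)
  moreover have "v \<in> F" using F0 by (simp add: F_def)
  ultimately obtain z b where "z \<in> F" "b \<notin> P" "b \<notin> F" "(z, b) \<in> E"
    using joined_exit [of v u E "- P" F] u v by auto
  with that [of F z b] finF disj F_conn F0 out_conn show thesis by (auto simp: F_def)
qed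

abbreviation near :: "'v \<Rightarrow> 'v \<Rightarrow> bool" where "near x y \<equiv> (x, y) \<in> E ^^ 3"

lemma near2: "(x, y) \<in> E \<Longrightarrow> (y, z) \<in> E \<Longrightarrow> near x z"
  using refl by (auto simp: numeral_3_eq_3)

lemma near3: "(x, y) \<in> E \<Longrightarrow> (y, z) \<in> E \<Longrightarrow> (z, u) \<in> E \<Longrightarrow> near x u"
  by (auto simp: numeral_3_eq_3)

lemma relpow_sym: "(x, y) \<in> E ^^ n \<Longrightarrow> (y, x) \<in> E ^^ n"
proof (induction n arbitrary: x y)
  case (Suc n)
  then show ?case using sym by (meson relpow_Suc_D2 relpow_Suc_E relpow_Suc_I relpow_Suc_I2)
qed auto

lemma relpow_mono: "(x, y) \<in> E ^^ m \<Longrightarrow> m \<le> n \<Longrightarrow> (x, y) \<in> E ^^ n"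
proof (induction n)
  case (Suc n)
  then show ?case using refl by (metis le_SucE relpow_Suc_I)
qed auto

text \<open>
  Sekanina's theorem that the cube of a finite connected graph has Hamiltonian paths, in a form suited to
  induction: both the start \<open>u\<close> and a vertex \<open>z\<close> adjacent to the end are prescribed. Remove a component \<open>D\<close>
  of \<open>F - {u}\<close>, which contains \<open>z\<close> unless \<open>z = u\<close>. Then traverse \<open>F - D\<close> from \<open>u\<close> back to a
  neighbour of \<open>u\<close>, jump into \<open>D\<close>, and traverse \<open>D\<close>. If \<open>z = u\<close>, the path through \<open>D\<close> is reversed so that
  it ends at a neighbour \<open>c\<close> of \<open>u\<close>; its new first vertex is then adjacent to \<open>c\<close>, which gives a jump of length 3.
\<close>
lemma hamiltonian_path_cube:
  assumes "finite F" "conn F" "u \<in> F" "z \<in> F"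
  shows "\<exists>Q. Q \<noteq> [] \<and> distinct Q \<and> set Q = F \<and> hd Q = u \<and> (last Q, z) \<in> E \<and> successively near Q"
  using assms
proof (induction "card F" arbitrary: F u z rule: less_induct)
  case less
  show ?case
  proof (cases "F = {u}")
    case True
    then show ?thesis using less.prems refl by (intro exI [of _ "[u]"]) auto
  next
    case False
    \<comment> \<open>The component to split off must contain the prescribed end, if that differs from the start.\<close>
    then obtain x where x: "x \<in> F" "x \<noteq> u" "z \<noteq> u \<longrightarrow> x = z"
      using less.prems by (cases "z = u") auto
    define D where "D = cmp (F - {u}) x"
    have DF: "D \<subseteq> F - {u}" using component_subset [of x "F - {u}" E] x by (simp add: D_def)
    have "x \<in> D" by (simp add: D_def)
    have conn_D: "conn D" by (simp add: D_def conn_component)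
    have to_u: "\<exists>c. c \<in> cmp (F - {u}) y \<and> (c, u) \<in> E" if "y \<in> F - {u}" for y
    proof -
      have "y \<in> F" using that by simp
      moreover have "(y, u) \<in> joined E F" using less.prems that by (simp add: connected_in_def)
      moreover have "u \<notin> cmp (F - {u}) y" using component_subset [OF that, of E] by auto
      ultimately obtain a b where ab: "a \<in> cmp (F - {u}) y" "b \<in> F" "b \<notin> cmp (F - {u}) y" "(a, b) \<in> E"
        using joined_exit [of y u E F "cmp (F - {u}) y"] by auto
      then have "b = u" using component_closed [of a E "F - {u}" y b] that by auto
      with ab show ?thesis by blast
    qed
    obtain c where c: "c \<in> D" "(c, u) \<in> E" using to_u [of x] x by (auto simp: D_def)
    have conn_rest: "conn (F - D)"
    proof -
      have "(y, u) \<in> joined E (F - D)" if y: "y \<in> F - D" for y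
      proof (cases "y = u")
        case False
        then obtain d where d: "d \<in> cmp (F - {u}) y" "(d, u) \<in> E" using to_u y by auto
        have sub: "cmp (F - {u}) y \<subseteq> F - D"
        proof
          fix t assume t: "t \<in> cmp (F - {u}) y"
          then have "t \<in> F" using component_subset [of y "F - {u}" E] False y by auto
          moreover have "t \<notin> D"
          proof
            assume "t \<in> D"
            then have "cmp (F - {u}) y = D"
              using component_eq [of t "F - {u}" x] component_eq [OF t] by (simp add: D_def)
            then show False using y component_self [of y E "F - {u}"] by simp
          qed
          ultimately show "t \<in> F - D" by simp
        qed
        have "(y, d) \<in> joined E (F - D)"
          using conn_component [of "F - {u}" y] d(1) joined_mono [OF sub]
          by (simp add: connected_in_def)
        moreover have "(d, u) \<in> joined E (F - D)"
          using d sub less.prems DF by (intro joined_edge) auto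
        ultimately show ?thesis by (rule joined_trans)
      qed simp
      then show ?thesis by (rule conn_star)
    qed
    have "finite D" using DF less.prems(1) finite_subset by blast
    have "card (F - D) < card F" "card D < card F"
      using less.prems(1,3) \<open>x \<in> D\<close> DF by (auto intro!: psubset_card_mono)
    obtain Q1 where Q1: "Q1 \<noteq> []" "distinct Q1" "set Q1 = F - D" "hd Q1 = u" "(last Q1, u) \<in> E"
        "successively near Q1"
      using less.hyps [OF \<open>card (F - D) < card F\<close>, of u u] less.prems conn_rest DF by auto
    have D_path: "\<exists>Q. Q \<noteq> [] \<and> distinct Q \<and> set Q = D \<and> hd Q = c \<and> (last Q, t) \<in> E \<and> successively near Q"
      if "t \<in> D" for t
      using less.hyps [OF \<open>card D < card F\<close>, of c t] that \<open>finite D\<close> conn_D c(1) by auto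
    show ?thesis
    proof (cases "z = u")
      case True
      obtain Q2 where Q2: "Q2 \<noteq> []" "distinct Q2" "set Q2 = D" "hd Q2 = c" "(last Q2, c) \<in> E"
          "successively near Q2"
        using D_path [OF c(1)] by blast
      have "near (last Q1) (hd (rev Q2))"
        using near3 [OF Q1(5) sym [OF c(2)] sym [OF Q2(5)]] by (simp add: hd_rev)
      moreover have "successively near (rev Q2)"
        using Q2(6) relpow_sym by (simp add: successively_mono)
      ultimately have "successively near (Q1 @ rev Q2)"
        using Q1 by (simp add: successively_append_iff)
      then show ?thesis
        using Q1 Q2 True DF c by (intro exI [of _ "Q1 @ rev Q2"]) (auto simp: last_rev)
    next
      case False
      then have "z \<in> D" using x \<open>x \<in> D\<close> by simp
      then obtain Q2 where Q2: "Q2 \<noteq> []" "distinct Q2" "set Q2 = D" "hd Q2 = c" "(last Q2, z) \<in> E"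
          "successively near Q2"
        using D_path by blast
      have "near (last Q1) (hd Q2)"
        using near2 [OF Q1(5) sym [OF c(2)]] Q2(4) by simp
      then have "successively near (Q1 @ Q2)"
        using Q1 Q2 by (simp add: successively_append_iff)
      then show ?thesis
        using Q1 Q2 DF by (intro exI [of _ "Q1 @ Q2"]) auto
    qed
  qed
qed

lemma walk_exists:
  assumes "(x, y) \<in> joined E A" "x \<in> A"
  shows "\<exists>p. p \<noteq> [] \<and> hd p = x \<and> last p = y \<and> set p \<subseteq> A \<and> successively (\<lambda>a b. (a, b) \<in> E) p"
  using assms(1) unfolding joined_def
proof (induction rule: rtrancl_induct)
  case base
  then show ?case using assms(2) by (intro exI [of _ "[x]"]) auto
next
  case (step y z)
  then obtain p where "p \<noteq> [] \<and> hd p = x \<and> last p = y \<and> set p \<subseteq> A \<and> successively (\<lambda>a b. (a, b) \<in> E) p"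
    by blast
  then show ?case
    using step.hyps by (intro exI [of _ "p @ [z]"]) (auto simp: successively_append_iff)
qed

lemma covering_walk:
  assumes "finite B" "B \<subseteq> A" "conn A" "v \<in> A"
  shows "\<exists>p. p \<noteq> [] \<and> hd p = v \<and> set p \<subseteq> A \<and> B \<subseteq> set p \<and> successively (\<lambda>a b. (a, b) \<in> E) p"
  using assms(1,2)
proof (induction rule: finite_induct)
  case empty
  then show ?case using assms(4) by (intro exI [of _ "[v]"]) auto
next
  case (insert b B)
  then obtain p where p: "p \<noteq> []" "hd p = v" "set p \<subseteq> A" "B \<subseteq> set p"
      "successively (\<lambda>a b. (a, b) \<in> E) p"
    by auto
  have "last p \<in> A" using p(1,3) by auto
  then have "(last p, b) \<in> joined E A" using assms(3) insert.prems by (simp add: connected_in_def)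
  then obtain q where q: "q \<noteq> []" "hd q = last p" "last q = b" "set q \<subseteq> A"
      "successively (\<lambda>a b. (a, b) \<in> E) q"
    using walk_exists [OF _ \<open>last p \<in> A\<close>] by blast
  have "b \<in> set q" using q(1,3) by auto
  then show ?case
    using p q refl by (intro exI [of _ "p @ q"]) (auto simp: successively_append_iff)
qed

end

section \<open>The integers on codes\<close>

lemma computable_even [comp_intros]:
  assumes "computable f" shows "computable (\<lambda>x. even (f x :: nat))"
proof -
  have "computable (\<lambda>x. rec_nat True (\<lambda>m r. \<not> r) (f x))" by (intro comp_intros assms)
  moreover have "rec_nat True (\<lambda>m r. \<not> r) n = even n" for n :: nat
    by (induction n) auto
  ultimately show ?thesis by simp
qed

text \<open>
  The successor on \<open>\<int>\<close> transported along the coding of integers by natural numbers, which lists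
  \<open>0, -1, 1, -2, 2, \<dots>\<close>. Composed with a Hamiltonian ray it turns the ray into a bi-infinite path.
\<close>
definition zsucc :: "nat \<Rightarrow> nat" where
  "zsucc n = int_encode (int_decode n + 1)"

lemma zsucc_eq: "zsucc n = (if even n then n + 2 else n - 2)"
proof (cases "even n")
  case True
  then obtain k where "n = 2 * k" by auto
  then show ?thesis
    by (simp add: zsucc_def int_encode_def int_decode_def sum_decode_def sum_encode_def nat_add_distrib)
next
  case False
  then obtain k where "n = 2 * k + 1" by (auto elim: oddE)
  then show ?thesis
    by (cases k) (simp_all add: zsucc_def int_encode_def int_decode_def sum_decode_def sum_encode_def)
qed

lemma funpow_zsucc: "(zsucc ^^ k) n = int_encode (int_decode n + int k)"
  by (induction k) (simp_all add: zsucc_def algebra_simps)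

lemma bij_zsucc: "bij zsucc"
proof (rule o_bij)
  show "(\<lambda>n. int_encode (int_decode n - 1)) \<circ> zsucc = id" 
    and "zsucc \<circ> (\<lambda>n. int_encode (int_decode n - 1)) = id"
    by (auto simp: zsucc_def)
qed

section \<open>One end: a computable Hamiltonian ray\<close>

locale computable_graph = graph E for E :: "(nat \<times> nat) set" +
  fixes nb :: "nat \<Rightarrow> nat list"
  assumes nb_iff: "(x, y) \<in> E \<longleftrightarrow> y \<in> set (nb x)"
    and computable_nb: "computable nb"
begin

definition walk_ends :: "nat \<Rightarrow> nat \<Rightarrow> nat list" where
  "walk_ends n x = ((\<lambda>xs. concat (map nb xs)) ^^ n) [x]"

lemma walk_ends_iff: "y \<in> set (walk_ends n x) \<longleftrightarrow> (x, y) \<in> E ^^ n"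
  by (induction n arbitrary: y) (auto simp: walk_ends_def relcomp.simps nb_iff)

lemma computable_walk_ends [comp_intros]:
  "computable f \<Longrightarrow> computable g \<Longrightarrow> computable (\<lambda>x. walk_ends (f x) (g x))"
  unfolding walk_ends_def by (intro comp_intros computable_compose [OF computable_nb])

lemma computable_relpow [comp_intros]:
  "computable n \<Longrightarrow> computable f \<Longrightarrow> computable g \<Longrightarrow> computable (\<lambda>x. (f x, g x) \<in> E ^^ n x)"
  unfolding walk_ends_iff [symmetric] by (intro comp_intros)

lemma computable_edge [comp_intros]:
  "computable f \<Longrightarrow> computable g \<Longrightarrow> computable (\<lambda>x. (f x, g x) \<in> E)"
  unfolding nb_iff by (intro comp_intros computable_compose [OF computable_nb])

text \<open>
  What a permutation of the vertices needs so that its powers form a computable translation-like action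
  of \<open>\<int>\<close> with decidable orbit membership.
\<close>
definition tame_free_permutation :: "(nat \<Rightarrow> nat) \<Rightarrow> bool" where
  "tame_free_permutation \<sigma> \<longleftrightarrow> computable \<sigma> \<and> bij \<sigma> \<and> (\<exists>k. \<forall>x. (x, \<sigma> x) \<in> E ^^ k) \<and>
     (\<forall>n x. (\<sigma> ^^ n) x = x \<longrightarrow> n = 0) \<and>
     computable (\<lambda>p. \<exists>n. (\<sigma> ^^ n) (fst p) = snd p \<or> (\<sigma> ^^ n) (snd p) = fst p)"

text \<open>
  A state of the search consists of the path built so far and a walk \<open>snd s\<close> in its complement. The
  walk starts close to the end of the path, so the path can be continued there, and it visits all outside
  neighbours of the path, which certifies that the complement is connected. Appending the head of the walk to
  the path expresses closeness also for the empty path.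
\<close>
definition extendable :: "nat list \<times> nat list \<Rightarrow> bool" where
  "extendable s \<longleftrightarrow> distinct (fst s) \<and> snd s \<noteq> [] \<and> successively near (fst s @ [hd (snd s)]) \<and>
     successively (\<lambda>x y. (x, y) \<in> E) (snd s) \<and> (\<forall>y\<in>set (snd s). y \<notin> set (fst s)) \<and>
     (\<forall>x\<in>set (fst s). \<forall>y\<in>set (nb x). y \<in> set (fst s) \<or> y \<in> set (snd s))"

lemma computable_extendable [comp_intros]:
  assumes "computable f" shows "computable (\<lambda>x. extendable (f x))"
  unfolding extendable_def
  by (intro comp_intros computable_compose [OF computable_nb] computable_compose [OF assms])

lemma walk_joined:
  assumes "successively (\<lambda>x y. (x, y) \<in> E) p" "set p \<subseteq> A" "x \<in> set p"
  shows "(hd p, x) \<in> joined E A"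
  using assms
proof (induction p)
  case (Cons a p)
  show ?case
  proof (cases "x = a")
    case False
    then have *: "p \<noteq> []" "(a, hd p) \<in> E" "(hd p, x) \<in> joined E A"
      using Cons by (auto simp: successively_Cons)
    then have "(a, hd p) \<in> joined E A"
      using Cons.prems hd_in_set [of p] by (intro joined_edge) auto
    with * show ?thesis using joined_trans by (metis list.sel(1))
  qed simp
qed simp

text \<open>
  Any path in the graph from a vertex outside \<open>L\<close> towards \<open>L\<close> first meets \<open>L\<close> at an outside neighbour of \<open>L\<close>,
  and all of these lie on the walk.
\<close>
lemma extendable_conn:
  assumes "extendable (L, p)" shows "conn (- set L)"
proof (cases "L = []")
  case True
  then show ?thesis using conn_UNIV by simp
next
  case False
  have pL: "set p \<subseteq> - set L" using assms by (auto simp: extendable_def)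
  have walk: "successively (\<lambda>x y. (x, y) \<in> E) p" using assms by (simp add: extendable_def)
  show ?thesis
  proof (rule conn_star)
    fix x assume x: "x \<in> - set L"
    have "hd L \<notin> - set L" using False by simp
    moreover have "(x, hd L) \<in> joined E UNIV" by (simp add: joined_UNIV connected)
    ultimately obtain a b where ab: "(x, a) \<in> joined E (- set L)" "a \<notin> set L" "b \<in> set L" "(a, b) \<in> E"
      using joined_exit [of x "hd L" E UNIV "- set L"] x by auto
    then have "a \<in> set p"
      using assms sym [of a b] by (auto simp: extendable_def nb_iff)
    then have "(hd p, a) \<in> joined E (- set L)" by (rule walk_joined [OF walk pL])
    then show "(x, hd p) \<in> joined E (- set L)"
      using ab(1) joined_sym joined_trans by metis
  qed
qed

text \<open>
  The next piece of the path runs through the set provided by \<open>one_ended_fill\<close> and starts at the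
  head of the certifying walk.
\<close>
lemma extendable_extend:
  assumes one_ended "extendable (L, p)"
  shows "\<exists>q. extendable (L @ fst q, snd q) \<and> n \<in> set (L @ fst q)"
proof (cases "n \<in> set L")
  case True
  then show ?thesis using assms by (intro exI [of _ "([], p)"]) simp
next
  case False
  have p: "p \<noteq> []" "hd p \<notin> set L" "distinct L" "successively near (L @ [hd p])"
    using assms(2) by (auto simp: extendable_def)
  obtain F z b where F: "finite F" "F \<inter> set L = {}" "conn F" "hd p \<in> F" "n \<in> F"
      "conn (- (set L \<union> F))" "z \<in> F" "b \<notin> set L \<union> F" "(z, b) \<in> E"
    using one_ended_fill [OF assms(1) infinite_UNIV_nat finite_set extendable_conn [OF assms(2)] p(2) False] .
  obtain Q where Q: "Q \<noteq> []" "distinct Q" "set Q = F" "hd Q = hd p" "(last Q, z) \<in> E" "successively near Q"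
    using hamiltonian_path_cube [OF F(1,3,4,7)] by blast
  define P where "P = set (L @ Q)"
  have P: "finite P" "P = set L \<union> F" using F(1) Q(3) by (simp_all add: P_def)
  have "E `` P - P \<subseteq> - P" by auto
  then obtain p' where p': "p' \<noteq> []" "hd p' = b" "set p' \<subseteq> - P" "E `` P - P \<subseteq> set p'"
      "successively (\<lambda>a b. (a, b) \<in> E) p'"
    using covering_walk [of "E `` P - P" "- P" b] F(6,8) finite_boundary [OF P(1)] P(2) by auto
  have "near (last Q) b" using near2 [OF Q(5) F(9)] .
  then have "successively near ((L @ Q) @ [b])"
    using p(4) Q by (auto simp: successively_append_iff)
  moreover have "distinct (L @ Q)" using p(3) Q(2,3) F(2) by auto
  moreover have "\<forall>x\<in>set (L @ Q). \<forall>y\<in>set (nb x). y \<in> set (L @ Q) \<or> y \<in> set p'"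
  proof (intro ballI)
    fix x y assume "x \<in> set (L @ Q)" "y \<in> set (nb x)"
    then have "y \<in> E `` P" unfolding P_def nb_iff [symmetric] by (rule ImageI [rotated])
    then show "y \<in> set (L @ Q) \<or> y \<in> set p'" using p'(4) unfolding P_def by blast
  qed
  ultimately have "extendable (L @ Q, p')"
    using p' by (auto simp: extendable_def P_def)
  moreover have "n \<in> set (L @ Q)" using F(5) Q(3) by simp
  ultimately show ?thesis by (intro exI [of _ "(Q, p')"]) simp
qed

text \<open>
  At stage \<open>n\<close> the path is extended so that it contains the vertex \<open>n\<close>. So after \<open>n\<close> stages it has at
  least \<open>n\<close> vertices, and the \<open>i\<close>-th vertex of the ray can be read off after \<open>i + 1\<close> stages.
\<close>
proposition computable_hamiltonian_ray:
  assumes one_ended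
  shows "\<exists>f. computable f \<and> bij f \<and> (\<forall>i. near (f i) (f (Suc i)))"
proof -
  have "computable (\<lambda>p. extendable (snd (fst p)) \<longrightarrow>
      extendable (fst (snd (fst p)) @ fst (snd p), snd (snd p)) \<and> fst (fst p) \<in> set (fst (snd (fst p)) @ fst (snd p)))"
    by (intro comp_intros)
  moreover have "\<exists>q. extendable (snd t) \<longrightarrow>
      extendable (fst (snd t) @ fst q, snd q) \<and> fst t \<in> set (fst (snd t) @ fst q)" for t :: "nat \<times> nat list \<times> nat list"
    using extendable_extend [OF assms, of "fst (snd t)" "snd (snd t)" "fst t"] by auto
  ultimately obtain ext where ext: "computable ext"
      "\<And>t. extendable (snd t) \<longrightarrow> extendable (fst (snd t) @ fst (ext t), snd (ext t)) \<and>
           fst t \<in> set (fst (snd t) @ fst (ext t))"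
    using computable_choice [of "\<lambda>t q. extendable (snd t) \<longrightarrow>
      extendable (fst (snd t) @ fst q, snd q) \<and> fst t \<in> set (fst (snd t) @ fst q)"] by blast
  define stage where "stage = rec_nat ([], [0 :: nat])
    (\<lambda>n s. (fst s @ fst (ext (n, s)), snd (ext (n, s))))"
  define L where "L n = fst (stage n)" for n
  define f where "f i = hd (drop i (L (Suc i)))" for i
  have comp: "computable f"
    unfolding f_def L_def stage_def by (intro comp_intros computable_compose [OF ext(1)])
  have extendable: "extendable (stage n)" for n
  proof (induction n)
    case 0
    then show ?case by (simp add: stage_def extendable_def)
  next
    case (Suc n)
    with ext(2) [of "(n, stage n)"] show ?case by (simp add: stage_def)
  qed
  have L_Suc: "L (Suc n) = L n @ fst (ext (n, stage n))" for n
    by (simp add: L_def stage_def)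
  have prefix: "\<exists>Q. L n = L m @ Q" if "m \<le> n" for m n
    using that by (induction n rule: dec_induct) (auto simp: L_Suc)
  have in_L: "n \<in> set (L (Suc n))" for n
    using ext(2) [of "(n, stage n)"] extendable [of n] L_Suc [of n] by (simp add: L_def)
  have distinct: "distinct (L n)" for n
    using extendable [of n] by (simp add: extendable_def L_def)
  have len: "n \<le> length (L n)" for n
  proof -
    have "{..<n} \<subseteq> set (L n)"
    proof
      fix k assume "k \<in> {..<n}"
      then obtain Q where "L n = L (Suc k) @ Q" using prefix [of "Suc k" n] by auto
      then show "k \<in> set (L n)" using in_L [of k] by simp
    qed
    then show ?thesis
      using card_mono [of "set (L n)" "{..<n}"] card_length [of "L n"] by simp
  qed
  have nth: "L n ! i = f i" if "i < length (L n)" for n i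
  proof -
    have i: "i < length (L (Suc i))" using len [of "Suc i"] by simp
    obtain Q Q' where "L (max n (Suc i)) = L n @ Q" "L (max n (Suc i)) = L (Suc i) @ Q'"
      using prefix [of n "max n (Suc i)"] prefix [of "Suc i" "max n (Suc i)"] by auto
    then have "L n ! i = L (Suc i) ! i" using that i by (metis nth_append)
    then show ?thesis using i by (simp add: f_def hd_drop_conv_nth)
  qed
  have "inj f"
  proof (rule injI)
    fix i j assume "f i = f j"
    moreover have "i < length (L (Suc (max i j)))" "j < length (L (Suc (max i j)))"
      using len [of "Suc (max i j)"] by auto
    ultimately show "i = j" using distinct nth by (metis nth_eq_iff_index_eq)
  qed
  moreover have "surj f"
  proof (rule surjI)
    show "f (SOME i. f i = x) = x" for x
      using in_L [of x] nth [of _ "Suc x"] by (metis (mono_tags) in_set_conv_nth someI)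
  qed
  moreover have "near (f i) (f (Suc i))" for i
  proof -
    have i: "Suc i < length (L (Suc (Suc i)))" using len [of "Suc (Suc i)"] by simp
    have "successively near (L (Suc (Suc i)))"
      using extendable [of "Suc (Suc i)"] by (auto simp: extendable_def L_def successively_append_iff)
    then have "near (L (Suc (Suc i)) ! i) (L (Suc (Suc i)) ! Suc i)"
      using i by (simp add: successively_conv_nth)
    then show ?thesis using i nth [of i "Suc (Suc i)"] nth [of "Suc i" "Suc (Suc i)"] by simp
  qed
  ultimately show ?thesis using comp by (auto simp: bij_def)
qed

text \<open>
  The permutation has a single orbit, therefore orbit membership is trivially decidable. Its steps have length
  at most 6, because \<open>zsucc\<close> moves an index by at most 2 and the ray has steps of length at most 3.
\<close>
proposition one_ended_tame_free_permutation:
  assumes one_ended shows "\<exists>\<sigma>. tame_free_permutation \<sigma>"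
proof -
  obtain f where f: "computable f" "bij f" "\<And>i. near (f i) (f (Suc i))"
    using computable_hamiltonian_ray [OF assms] by auto
  define h where "h = inv_into UNIV f"
  have fh: "f (h x) = x" and hf: "h (f x) = x" for x
    using f(2) by (auto simp: h_def bij_is_surj surj_f_inv_f bij_is_inj)
  define \<sigma> where "\<sigma> x = f (zsucc (h x))" for x
  have pow: "(\<sigma> ^^ n) x = f ((zsucc ^^ n) (h x))" for n x
    by (induction n) (simp_all add: \<sigma>_def fh hf)
  have orbits: "\<exists>n. (\<sigma> ^^ n) x = y \<or> (\<sigma> ^^ n) y = x" for x y
  proof -
    define i j where "i = int_decode (h x)" and "j = int_decode (h y)"
    have x: "x = f (int_encode i)" and y: "y = f (int_encode j)" by (simp_all add: i_def j_def fh)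
    have pow': "(\<sigma> ^^ n) (f (int_encode k)) = f (int_encode (k + int n))" for n k
      by (simp add: pow hf funpow_zsucc)
    show ?thesis
    proof (cases "i \<le> j")
      case True
      then have "(\<sigma> ^^ nat (j - i)) x = y" by (simp add: x y pow')
      then show ?thesis by blast
    next
      case False
      then have "(\<sigma> ^^ nat (i - j)) y = x" by (simp add: x y pow')
      then show ?thesis by blast
    qed
  qed
  have "computable (\<lambda>x. f (if even (h x) then h x + 2 else h x - 2))"
    by (intro comp_intros computable_compose [OF f(1)]
        computable_compose [OF computable_inv [OF f(1,2), folded h_def]])
  moreover have "\<sigma> = (\<lambda>x. f (if even (h x) then h x + 2 else h x - 2))"
    by (simp add: \<sigma>_def zsucc_eq fun_eq_iff)
  ultimately have "computable \<sigma>" by simp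
  moreover have "bij \<sigma>"
  proof -
    have "bij h" unfolding h_def using f(2) by (rule bij_imp_bij_inv)
    then have "bij (f \<circ> (zsucc \<circ> h))" using f(2) bij_zsucc by (intro bij_comp)
    moreover have "f \<circ> (zsucc \<circ> h) = \<sigma>" by (auto simp: \<sigma>_def)
    ultimately show ?thesis by simp
  qed
  moreover have "(x, \<sigma> x) \<in> E ^^ 6" for x
  proof -
    have two: "(f i, f (i + 2)) \<in> E ^^ 6" for i
    proof -
      have "(f i, f (i + 2)) \<in> E ^^ 3 O E ^^ 3" using f(3) [of i] f(3) [of "Suc i"] by auto
      moreover have "E ^^ 3 O E ^^ 3 = E ^^ 6" by (simp flip: relpow_add)
      ultimately show ?thesis by simp
    qed
    have "h x = h x - 2 + 2" if "odd (h x)" "h x \<noteq> 1"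
      using that by (cases "h x"; cases "h x - 1") auto
    then consider "even (h x)" | "h x = 1" | i where "h x = i + 2" "odd (h x)"
      by metis
    then show ?thesis
    proof cases
      case 1
      then show ?thesis using two [of "h x"] by (simp add: \<sigma>_def zsucc_eq fh)
    next
      case 2
      have "near (f 1) (f 0)" using relpow_sym [OF f(3) [of 0]] by simp
      then have "(f 1, f 0) \<in> E ^^ 6" by (rule relpow_mono) simp
      then show ?thesis using 2 fh [of x] by (simp add: \<sigma>_def zsucc_eq)
    next
      case 3
      then show ?thesis using relpow_sym [OF two [of i]] fh [of x] by (simp add: \<sigma>_def zsucc_eq)
    qed
  qed
  moreover have "n = 0" if "(\<sigma> ^^ n) x = x" for n x
  proof -
    have "f ((zsucc ^^ n) (h x)) = f (h x)" using that by (simp add: pow fh)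
    then have "(zsucc ^^ n) (h x) = h x" using f(2) by (simp add: bij_is_inj inj_eq)
    then have "int_encode (int_decode (h x) + int n) = int_encode (int_decode (h x))"
      by (simp add: funpow_zsucc)
    then show ?thesis by (simp only: int_encode_eq)
  qed
  ultimately show ?thesis
    unfolding tame_free_permutation_def using orbits by (intro exI [of _ \<sigma>]) (auto simp: computable_const)
qed

end

section \<open>Several ends: an undistorted cyclic subgroup\<close>

locale computable_cayley_graph = computable_graph E nb + group H
  for E nb and H (structure) +
  assumes carrier [simp]: "carrier H = UNIV"
    and left_invariant: "(x, y) \<in> E \<Longrightarrow> (g \<otimes> x, g \<otimes> y) \<in> E"
    and computable_mult: "computable (\<lambda>p. fst p \<otimes> snd p)"
begin

definition translate :: "nat \<Rightarrow> nat set \<Rightarrow> nat set" where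
  "translate g A = (\<lambda>x. g \<otimes> x) ` A"

lemma mem_translate: "x \<in> translate g A \<longleftrightarrow> inv g \<otimes> x \<in> A"
proof
  assume "x \<in> translate g A"
  then show "inv g \<otimes> x \<in> A" by (auto simp: translate_def m_assoc [symmetric])
next
  assume "inv g \<otimes> x \<in> A"
  then show "x \<in> translate g A"
    unfolding translate_def by (rule image_eqI [rotated]) (simp add: m_assoc [symmetric])
qed

lemma translate_mult: "translate (g \<otimes> h) A = translate g (translate h A)"
  by (auto simp: translate_def m_assoc image_image)

lemma translate_one: "translate \<one> A = A"
  by (auto simp: translate_def)

lemma translate_mono: "A \<subseteq> B \<Longrightarrow> translate g A \<subseteq> translate g B"
  by (auto simp: translate_def)

lemma conn_translate:
  assumes "conn A" shows "conn (translate g A)"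
proof -
  have "(g \<otimes> x, g \<otimes> y) \<in> joined E (translate g A)" if "(x, y) \<in> joined E A" for x y
    using that unfolding joined_def [of E A]
  proof (induction rule: rtrancl_induct)
    case (step y z)
    then have "(g \<otimes> y, g \<otimes> z) \<in> joined E (translate g A)"
      by (intro joined_edge left_invariant) (auto simp: translate_def)
    with step.IH show ?case by (rule joined_trans)
  qed simp
  then show ?thesis using assms by (auto simp: connected_in_def translate_def)
qed

lemma relpow_left_invariant: "(x, y) \<in> E ^^ n \<Longrightarrow> (g \<otimes> x, g \<otimes> y) \<in> E ^^ n"
  by (induction n arbitrary: y) (auto intro: left_invariant)

text \<open>
  Only finitely many translates of \<open>K\<close> meet \<open>K\<close>, and an infinite component contains more elements than these.
  Translated by another element of the component, \<open>K\<close> stays connected, avoids \<open>K\<close> and contains that element, so it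
  lies in the component.
\<close>
lemma translate_into_component:
  assumes K: "finite K" "conn K" "\<one> \<in> K" and d: "d \<notin> K" "infinite (cmp (- K) d)"
  obtains g where "translate g K \<subseteq> cmp (- K) d" "translate g K \<inter> K = {}"
proof -
  have "finite ((\<lambda>(k, l). k \<otimes> inv l) ` (K \<times> K))" using K(1) by simp
  then obtain g where g: "g \<in> cmp (- K) d" "g \<notin> (\<lambda>(k, l). k \<otimes> inv l) ` (K \<times> K)"
    using d(2) by (metis finite_subset subsetI)
  have disj: "translate g K \<inter> K = {}"
  proof (rule ccontr)
    assume "translate g K \<inter> K \<noteq> {}"
    then obtain l where l: "l \<in> K" "g \<otimes> l \<in> K" by (auto simp: translate_def)
    have "g = (g \<otimes> l) \<otimes> inv l" by (simp add: m_assoc)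
    with l g(2) show False by (auto simp: image_iff)
  qed
  have "g \<in> translate g K" using K(3) by (force simp: translate_def)
  then have "translate g K \<subseteq> cmp (- K) g"
    using connected_in_subset_component [OF conn_translate [OF K(2)], of g "- K" g] disj by auto
  then have "translate g K \<subseteq> cmp (- K) d" using component_eq [OF g(1)] by simp
  then show thesis using that disj by blast
qed

text \<open>
  A translated component that avoids \<open>K\<close> is connected and touches the translate of \<open>K\<close>, so it is
  contained in the component of the complement of \<open>K\<close> in which this translate lies.
\<close>
lemma translate_component_subset:
  assumes "translate g K \<subseteq> cmp (- K) d" "d \<notin> K" "K \<noteq> {}" "e \<notin> K"
    and disj: "K \<inter> translate g (cmp (- K) e) = {}"
  shows "translate g (cmp (- K) e) \<subseteq> cmp (- K) d"
proof -
  obtain a b where ab: "a \<in> cmp (- K) e" "b \<in> K" "(a, b) \<in> E"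
    using component_boundary [OF assms(4,3)] .
  have ga: "g \<otimes> a \<in> translate g (cmp (- K) e)" using ab(1) by (simp add: translate_def)
  have "g \<otimes> b \<in> cmp (- K) d" using assms(1) ab(2) by (auto simp: translate_def)
  then have "g \<otimes> a \<in> cmp (- K) d"
    using component_closed [of "g \<otimes> b" E "- K" d "g \<otimes> a"] left_invariant [OF sym [OF ab(3)], of g]
      assms(2) ga disj by auto
  moreover have "translate g (cmp (- K) e) \<subseteq> cmp (- K) (g \<otimes> a)"
    using connected_in_subset_component [OF conn_translate [OF conn_component] _ ga, of "- K"] disj
    by auto
  ultimately show ?thesis using component_eq by simp
qed

text \<open>
  Seen from \<open>g K\<close>, the connected set \<open>K\<close> lies on a single side.
\<close>
lemma translate_component_unique:
  assumes "conn K" "translate g K \<inter> K = {}"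
    and "K \<inter> translate g (cmp (- K) d) \<noteq> {}" "K \<inter> translate g (cmp (- K) e) \<noteq> {}"
  shows "cmp (- K) d = cmp (- K) e"
proof -
  obtain p q where p: "p \<in> cmp (- K) d" "g \<otimes> p \<in> K" and q: "q \<in> cmp (- K) e" "g \<otimes> q \<in> K"
    using assms(3,4) by (auto simp: translate_def)
  have cancel: "inv g \<otimes> (g \<otimes> x) = x" for x by (simp add: m_assoc [symmetric])
  have "p \<in> translate (inv g) K" "q \<in> translate (inv g) K"
    using p q cancel by (metis image_eqI translate_def)+
  moreover have "translate (inv g) K \<subseteq> - K"
  proof
    fix x assume "x \<in> translate (inv g) K"
    then have "g \<otimes> x \<in> K" by (simp add: mem_translate)
    then show "x \<in> - K" using assms(2) by (auto simp: translate_def)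
  qed
  ultimately have "q \<in> cmp (- K) p"
    using connected_in_subset_component [OF conn_translate [OF assms(1)]] by blast
  then show ?thesis using component_eq p(1) q(1) by metis
qed

text \<open>
  Let \<open>C\<^sub>1\<close> and \<open>C\<^sub>2\<close> be two infinite components of the complement of a finite connected set \<open>K\<close>, and
  let \<open>g\<close> and \<open>h\<close> move \<open>K\<close> into \<open>C\<^sub>1\<close> and \<open>C\<^sub>2\<close>. If \<open>g C\<^sub>1\<close> avoids \<open>K\<close>, it is a proper subset of
  \<open>C\<^sub>1\<close>, and similarly for \<open>h\<close> and \<open>C\<^sub>2\<close>. Otherwise \<open>K\<close> lies in \<open>g C\<^sub>1\<close> and in \<open>h C\<^sub>2\<close>, hence
  \<open>g C\<^sub>2 \<subset> C\<^sub>1\<close> and \<open>h C\<^sub>1 \<subset> C\<^sub>2\<close>, and the product \<open>g h\<close> shrinks \<open>C\<^sub>1\<close>.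
\<close>
proposition shrinking_translate:
  assumes "\<not> one_ended"
  obtains g C where "translate g C \<subset> C" "finite {x \<in> C. \<exists>y. y \<notin> C \<and> (x, y) \<in> E}"
proof -
  obtain K0 x0 y0 where K0: "finite K0" "x0 \<notin> K0" "y0 \<notin> K0" "infinite (cmp (- K0) x0)"
      "infinite (cmp (- K0) y0)" "cmp (- K0) x0 \<noteq> cmp (- K0) y0"
    using assms by (auto simp: one_ended_def)
  \<comment> \<open>The separating set is enlarged to a connected one, and each end keeps an infinite component outside.\<close>
  obtain K where K: "finite K" "conn K" "insert \<one> K0 \<subseteq> K"
    using finite_conn_superset [OF K0(1) subset_UNIV conn_UNIV UNIV_I] by metis
  have oneK: "\<one> \<in> K" and K_ne: "K \<noteq> {}" using K(3) by auto
  have refine: "\<exists>x'. x' \<notin> K \<and> infinite (cmp (- K) x') \<and> x' \<in> cmp (- K0) x"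
    if "infinite (cmp (- K0) x)" for x
  proof -
    have "infinite (cmp (- K0) x - K)" using that K(1) by simp
    then obtain x' where "x' \<in> cmp (- K0) x - K" "infinite (cmp (- K) x')"
      using infinite_component_in [OF K(1) K_ne] by blast
    then show ?thesis by blast
  qed
  obtain d where d: "d \<notin> K" "infinite (cmp (- K) d)" "d \<in> cmp (- K0) x0" using refine K0(4) by blast
  obtain e where e: "e \<notin> K" "infinite (cmp (- K) e)" "e \<in> cmp (- K0) y0" using refine K0(5) by blast
  have ne: "cmp (- K) d \<noteq> cmp (- K) e"
  proof
    assume "cmp (- K) d = cmp (- K) e"
    then have "e \<in> cmp (- K0) d"
      using component_self [of e E "- K"] component_mono [of "- K" "- K0" E d] K(3) by auto
    then show False using component_eq d(3) e(3) K0(6) by metis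
  qed
  have bd: "finite {x \<in> cmp (- K) c. \<exists>y. y \<notin> cmp (- K) c \<and> (x, y) \<in> E}" if "c \<notin> K" for c
  proof (rule finite_subset)
    show "{x \<in> cmp (- K) c. \<exists>y. y \<notin> cmp (- K) c \<and> (x, y) \<in> E} \<subseteq> E `` K"
      using component_closed [of _ E "- K" c] that sym by blast
  qed (simp add: finite_boundary K)
  have strict: "translate g (cmp (- K) b) \<noteq> cmp (- K) c"
    if "translate g K \<subseteq> cmp (- K) c" "b \<notin> K" for g b c
  proof
    assume eq: "translate g (cmp (- K) b) = cmp (- K) c"
    have "g \<in> translate g K" using oneK by (force simp: translate_def)
    then have "g \<in> translate g (cmp (- K) b)" using that eq by auto
    then have "\<one> \<in> cmp (- K) b" by (simp add: mem_translate)
    then show False using component_subset [of b "- K" E] that oneK by auto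
  qed
  obtain g where g: "translate g K \<subseteq> cmp (- K) d" "translate g K \<inter> K = {}"
    using translate_into_component [OF K(1,2) oneK d(1,2)] .
  obtain h where h: "translate h K \<subseteq> cmp (- K) e" "translate h K \<inter> K = {}"
    using translate_into_component [OF K(1,2) oneK e(1,2)] .
  consider "K \<inter> translate g (cmp (- K) d) = {}" | "K \<inter> translate h (cmp (- K) e) = {}"
    | "K \<inter> translate g (cmp (- K) e) = {}" "K \<inter> translate h (cmp (- K) d) = {}"
    using translate_component_unique [OF K(2) g(2), of d e]
      translate_component_unique [OF K(2) h(2), of d e] ne by blast
  then show thesis
  proof cases
    case 1
    then show thesis
      using that [of g] translate_component_subset [OF g(1) d(1) K_ne d(1)] strict [OF g(1) d(1)] bd [OF d(1)]
      by blast
  next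
    case 2
    then show thesis
      using that [of h] translate_component_subset [OF h(1) e(1) K_ne e(1)] strict [OF h(1) e(1)] bd [OF e(1)]
      by blast
  next
    case 3
    have "translate h (cmp (- K) d) \<subseteq> cmp (- K) e"
      by (rule translate_component_subset [OF h(1) e(1) K_ne d(1) 3(2)])
    then have "translate (g \<otimes> h) (cmp (- K) d) \<subseteq> translate g (cmp (- K) e)"
      unfolding translate_mult by (rule translate_mono)
    also have "\<dots> \<subset> cmp (- K) d"
      using translate_component_subset [OF g(1) d(1) K_ne e(1) 3(1)] strict [OF g(1) e(1)] by blast
    finally show thesis using that bd [OF d(1)] by blast
  qed
qed

text \<open>
  Fix \<open>x\<^sub>0\<close> in \<open>C\<close> but not in \<open>g C\<close>. A path from \<open>x\<^sub>0\<close> to \<open>g\<^sup>m x\<^sub>0\<close> enters each of the nested sets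
  \<open>g C, \<dots>, g\<^sup>m C\<close>, and it does so at a point \<open>g\<^sup>i b\<close> with \<open>b\<close> in the boundary of \<open>C\<close>. The pair of the
  position on the path and \<open>b\<close> determines \<open>i\<close>, because \<open>g\<close> has infinite order. So \<open>m\<close> is at most the number
  of positions times the size of the boundary.
\<close>
proposition undistorted_element:
  assumes "translate g C \<subset> C" and fin: "finite {x \<in> C. \<exists>y. y \<notin> C \<and> (x, y) \<in> E}" (is "finite ?B")
  shows "\<exists>c. \<forall>x m L. (x, x \<otimes> g [^] (m::nat)) \<in> E ^^ L \<longrightarrow> m \<le> (L + c) * c" (is ?undistorted)
    and "\<forall>m. g [^] (m::nat) = \<one> \<longrightarrow> m = 0" (is ?order)
proof -
  obtain x0 where x0: "x0 \<in> C" "x0 \<notin> translate g C" using assms(1) by blast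
  have pow_sub: "translate (g [^] n) C \<subseteq> C" for n :: nat
  proof (induction n)
    case (Suc n)
    have "translate (g [^] Suc n) C = translate (g [^] n) (translate g C)"
      by (simp add: translate_mult)
    also have "\<dots> \<subseteq> translate (g [^] n) C" using assms(1) by (intro translate_mono) auto
    finally show ?case using Suc by simp
  qed (simp add: translate_one)
  have x0_pow: "x0 \<notin> translate (g [^] n) C" if "n > 0" for n :: nat
  proof -
    obtain k where k: "n = Suc k" using \<open>n > 0\<close> by (cases n) auto
    have "g [^] n = g \<otimes> g [^] k" unfolding k by (rule nat_pow_Suc2) simp
    then have "translate (g [^] n) C = translate g (translate (g [^] k) C)"
      by (simp add: translate_mult)
    also have "\<dots> \<subseteq> translate g C" by (intro translate_mono pow_sub)
    finally show ?thesis using x0 by blast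
  qed
  have order: "m = 0" if "g [^] m = \<one>" for m :: nat
    using x0_pow [of m] x0(1) that by (auto simp: translate_one)
  have inj_pow: "i = j" if "g [^] i = g [^] j" for i j :: nat
    using that
  proof (induction i j rule: linorder_wlog)
    case (le i j)
    have "g [^] i \<otimes> g [^] (j - i) = g [^] (i + (j - i))" by (rule nat_pow_mult) simp
    then have "g [^] i \<otimes> g [^] (j - i) = g [^] i \<otimes> \<one>" using le by simp
    then have "g [^] (j - i) = \<one>" by simp
    then show ?case using order le by fastforce
  qed simp
  obtain a where a: "(\<one>, x0) \<in> E ^^ a" using connected rtrancl_imp_relpow by metis
  \<comment> \<open>One constant serves as additive and as multiplicative bound; \<open>a\<close> bounds the distance of \<open>x0\<close> from the neutral element.\<close>
  define c where "c = 2 * a + 1 + card ?B"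
  have "m \<le> (L + c) * c" if "(x, x \<otimes> g [^] m) \<in> E ^^ L" for x L and m :: nat
  proof -
    define M where "M = a + (L + a)"
    have "(inv x \<otimes> x, inv x \<otimes> (x \<otimes> g [^] m)) \<in> E ^^ L" using that by (rule relpow_left_invariant)
    then have "(\<one>, g [^] m) \<in> E ^^ L" by (simp add: m_assoc [symmetric])
    moreover have "(x0, \<one>) \<in> E ^^ a" using a by (rule relpow_sym)
    moreover have "(g [^] m, g [^] m \<otimes> x0) \<in> E ^^ a"
      using relpow_left_invariant [OF a, of "g [^] m"] by simp
    ultimately have "(x0, g [^] m \<otimes> x0) \<in> E ^^ M" unfolding M_def relpow_add by blast
    then obtain f where f: "f 0 = x0" "f M = g [^] m \<otimes> x0" "\<And>i. i < M \<Longrightarrow> (f i, f (Suc i)) \<in> E"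
      by (auto simp: relpow_fun_conv)
    have "\<exists>jb. fst jb \<le> M \<and> snd jb \<in> ?B \<and> f (fst jb) = g [^] i \<otimes> snd jb" if i: "i \<in> {1..m}" for i
    proof -
      have "translate (g [^] m) C = translate (g [^] i) (translate (g [^] (m - i)) C)"
        using i by (simp add: translate_mult [symmetric] nat_pow_mult)
      also have "\<dots> \<subseteq> translate (g [^] i) C" by (intro translate_mono pow_sub)
      finally have fM: "f M \<in> translate (g [^] i) C" using x0(1) f(2) by (auto simp: translate_def)
      \<comment> \<open>The first time at which the path enters the translate \<open>g\<^sup>i C\<close>.\<close>
      define j where "j = (LEAST j. f j \<in> translate (g [^] i) C)"
      have fj: "f j \<in> translate (g [^] i) C" unfolding j_def by (rule LeastI) (rule fM)
      have jM: "j \<le> M" unfolding j_def by (rule Least_le) (rule fM)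
      have "j \<noteq> 0" using fj x0_pow [of i] i f(1) by (cases "j = 0") auto
      then obtain k where k: "j = Suc k" using not0_implies_Suc by blast
      have fk: "f k \<notin> translate (g [^] i) C" using not_less_Least [of k "\<lambda>j. f j \<in> translate (g [^] i) C"] k
        unfolding j_def by auto
      have "(f k, f j) \<in> E" using f(3) [of k] jM k by simp
      then have "(inv (g [^] i) \<otimes> f j, inv (g [^] i) \<otimes> f k) \<in> E" by (rule left_invariant [OF sym])
      then have "inv (g [^] i) \<otimes> f j \<in> ?B" using fj fk by (auto simp: mem_translate)
      moreover have "f j = g [^] i \<otimes> (inv (g [^] i) \<otimes> f j)" by (simp add: m_assoc [symmetric])
      ultimately show ?thesis using jM by (intro exI [of _ "(j, inv (g [^] i) \<otimes> f j)"]) auto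
    qed
    then have "\<forall>i\<in>{1..m}. \<exists>jb. fst jb \<le> M \<and> snd jb \<in> ?B \<and> f (fst jb) = g [^] i \<otimes> snd jb"
      by (rule ballI)
    from bchoice [OF this] obtain \<phi> where \<phi>: "\<forall>i\<in>{1..m}. fst (\<phi> i) \<le> M \<and> snd (\<phi> i) \<in> ?B \<and>
        f (fst (\<phi> i)) = g [^] i \<otimes> snd (\<phi> i)" ..
    have "inj_on \<phi> {1..m}"
    proof (rule inj_onI)
      fix i j assume ij: "i \<in> {1..m}" "j \<in> {1..m}" "\<phi> i = \<phi> j"
      then have "g [^] i \<otimes> snd (\<phi> j) = g [^] j \<otimes> snd (\<phi> j)"
        using bspec [OF \<phi> ij(1)] bspec [OF \<phi> ij(2)] by simp
      then have "g [^] i = g [^] j" by simp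
      then show "i = j" by (rule inj_pow)
    qed
    moreover have "\<phi> ` {1..m} \<subseteq> {..M} \<times> ?B"
    proof
      fix p assume "p \<in> \<phi> ` {1..m}"
      then obtain i where i: "i \<in> {1..m}" "p = \<phi> i" by blast
      from bspec [OF \<phi> i(1)] show "p \<in> {..M} \<times> ?B" unfolding i(2) [symmetric] by (simp add: mem_Times_iff)
    qed
    ultimately have "card {1..m} \<le> card ({..M} \<times> ?B)"
      using fin by (intro card_inj_on_le) auto
    then have "m \<le> Suc M * card ?B" by (simp add: card_cartesian_product)
    also have "\<dots> \<le> (L + c) * c" by (intro mult_mono) (auto simp: M_def c_def)
    finally show ?thesis .
  qed
  then show ?undistorted by blast
  show ?order using order by blast
qed

proposition multi_ended_tame_free_permutation:
  assumes "\<not> one_ended" shows "\<exists>\<sigma>. tame_free_permutation \<sigma>"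
proof -
  obtain g C where gC: "translate g C \<subset> C" "finite {x \<in> C. \<exists>y. y \<notin> C \<and> (x, y) \<in> E}"
    using shrinking_translate [OF assms] .
  obtain c where c: "\<And>x m L. (x, x \<otimes> g [^] (m::nat)) \<in> E ^^ L \<Longrightarrow> m \<le> (L + c) * c"
    using undistorted_element(1) [OF gC] by blast
  have order: "m = 0" if "g [^] m = \<one>" for m :: nat
    using undistorted_element(2) [OF gC] that by blast
  define \<sigma> where "\<sigma> x = x \<otimes> g" for x
  have pow: "(\<sigma> ^^ n) x = x \<otimes> g [^] n" for n x
    by (induction n) (simp_all add: \<sigma>_def m_assoc)
  have comp: "computable \<sigma>"
    unfolding \<sigma>_def by (intro computable_compose2 [OF computable_mult] comp_intros)
  have "bij \<sigma>"
  proof (rule o_bij)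
    show "(\<lambda>x. x \<otimes> inv g) \<circ> \<sigma> = id" "\<sigma> \<circ> (\<lambda>x. x \<otimes> inv g) = id"
      by (auto simp: \<sigma>_def m_assoc)
  qed
  moreover obtain k where "(\<one>, g) \<in> E ^^ k" using connected rtrancl_imp_relpow by metis
  then have "(x, \<sigma> x) \<in> E ^^ k" for x
    using relpow_left_invariant [of "\<one>" g k x] by (simp add: \<sigma>_def)
  moreover have "n = 0" if "(\<sigma> ^^ n) x = x" for n x
  proof -
    have "x \<otimes> g [^] n = x \<otimes> \<one>" using that by (simp add: pow)
    then have "g [^] n = \<one>" by simp
    then show ?thesis by (rule order)
  qed
  moreover have "computable (\<lambda>p. \<exists>n. (\<sigma> ^^ n) (fst p) = snd p \<or> (\<sigma> ^^ n) (snd p) = fst p)"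
  proof -
    have "computable (\<lambda>p :: (nat \<times> nat) \<times> nat. (fst (fst p), snd (fst p)) \<in> E ^^ snd p)"
      by (intro comp_intros)
    moreover have "\<exists>n. (fst p, snd p) \<in> E ^^ n" for p using connected rtrancl_imp_relpow by metis
    ultimately obtain len where len: "computable len" "\<And>p. (fst p, snd p) \<in> E ^^ len p"
      using computable_choice [of "\<lambda>p n. (fst p, snd p) \<in> E ^^ n"] by blast
    \<comment> \<open>Two elements at distance at most \<open>len p\<close> can only differ by a power of \<open>g\<close> with linearly bounded exponent.\<close>
    have "(\<exists>n. (\<sigma> ^^ n) (fst p) = snd p \<or> (\<sigma> ^^ n) (snd p) = fst p) \<longleftrightarrow>
        (\<exists>n\<in>set [0..<Suc ((len p + c) * c)]. (\<sigma> ^^ n) (fst p) = snd p \<or> (\<sigma> ^^ n) (snd p) = fst p)" for p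
    proof -
      have "n \<le> (len p + c) * c" if "(\<sigma> ^^ n) (fst p) = snd p" for n
        using c [of "fst p" n "len p"] len(2) [of p] that by (simp add: pow)
      moreover have "n \<le> (len p + c) * c" if "(\<sigma> ^^ n) (snd p) = fst p" for n
        using c [of "snd p" n "len p"] relpow_sym [OF len(2) [of p]] that by (simp add: pow)
      ultimately show ?thesis by (auto simp: less_Suc_eq_le simp del: upt_Suc)
    qed
    moreover have "computable (\<lambda>p. \<exists>n\<in>set [0..<Suc ((len p + c) * c)].
        (\<sigma> ^^ n) (fst p) = snd p \<or> (\<sigma> ^^ n) (snd p) = fst p)"
      by (intro comp_intros computable_compose [OF len(1)] computable_compose [OF comp])
    ultimately show ?thesis by simp
  qed
  ultimately show ?thesis using comp unfolding tame_free_permutation_def by blast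
qed

proposition tame_free_permutation_exists: "\<exists>\<sigma>. tame_free_permutation \<sigma>"
  using one_ended_tame_free_permutation multi_ended_tame_free_permutation by blast

end

section \<open>Enumerations and integer powers\<close>

lemma computable_half [comp_intros]:
  assumes "computable f" shows "computable (\<lambda>x. f x div (2 :: nat))"
proof -
  have "computable (\<lambda>x. rec_nat 0 (\<lambda>m r. if even m then r else Suc r) (f x))"
    by (intro comp_intros assms)
  moreover have "rec_nat 0 (\<lambda>m r. if even m then r else Suc r) n = n div 2" for n :: nat
    by (induction n) auto
  ultimately show ?thesis by simp
qed

lemma decidable_set_iff_computable: "decidable_set A \<longleftrightarrow> computable (\<lambda>n. n \<in> A)"
  by (simp add: decidable_set_def computable_def rec1_def enc_bool_def dec_nat_def of_bool_def cong: if_cong)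

lemma computable_enumerate:
  fixes D :: "nat set"
  assumes "computable (\<lambda>n. n \<in> D)" "infinite D"
  shows "computable (enumerate D)"
proof -
  have "\<exists>n. (n \<in> D \<and> m < n) \<and> (\<forall>k\<in>set [0..<n]. \<not> (k \<in> D \<and> m < k))" for m
  proof -
    have "\<exists>n. n \<in> D \<and> m < n" using assms(2) by (meson infinite_nat_iff_unbounded)
    then have "let n = LEAST n. n \<in> D \<and> m < n in
        (n \<in> D \<and> m < n) \<and> (\<forall>k\<in>set [0..<n]. \<not> (k \<in> D \<and> m < k))"
      unfolding Let_def using LeastI_ex [of "\<lambda>n. n \<in> D \<and> m < n"]
        not_less_Least [of _ "\<lambda>n. n \<in> D \<and> m < n"] by auto
    then show ?thesis unfolding Let_def by blast
  qed
  moreover have "computable (\<lambda>p. (snd p \<in> D \<and> fst p < snd p) \<and>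
      (\<forall>k\<in>set [0..<snd p]. \<not> (k \<in> D \<and> fst p < k)))"
    by (intro comp_intros computable_compose [OF assms(1)])
  ultimately obtain next_in where next_in: "computable next_in" "\<And>m. (next_in m \<in> D \<and> m < next_in m) \<and>
      (\<forall>k\<in>set [0..<next_in m]. \<not> (k \<in> D \<and> m < k))"
    using computable_choice [of "\<lambda>m n. (n \<in> D \<and> m < n) \<and> (\<forall>k\<in>set [0..<n]. \<not> (k \<in> D \<and> m < k))"]
    by blast
  have next_in_eq: "next_in m = (LEAST n. n \<in> D \<and> m < n)" for m
    by (rule Least_equality [symmetric]) (use next_in(2) [of m] in \<open>auto simp: not_less [symmetric]\<close>)
  have "rec_nat (enumerate D 0) (\<lambda>m r. next_in r) n = enumerate D n" for n
    by (induction n) (simp_all add: enumerate_Suc'' [OF assms(2)] next_in_eq del: enumerate.simps)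
  moreover have "computable (\<lambda>n. rec_nat (enumerate D 0) (\<lambda>m r. next_in r) n)"
    by (intro comp_intros computable_compose [OF next_in(1)])
  ultimately show ?thesis by (simp only:)
qed

definition zpow :: "('x \<Rightarrow> 'x) \<Rightarrow> int \<Rightarrow> 'x \<Rightarrow> 'x" where
  "zpow \<sigma> n = (if 0 \<le> n then \<sigma> ^^ nat n else inv_into UNIV \<sigma> ^^ nat (- n))"

context
  fixes \<sigma> :: "'x \<Rightarrow> 'x"
  assumes bij: "bij \<sigma>"
begin

lemma bij_cancel: "\<sigma> (inv_into UNIV \<sigma> x) = x" "inv_into UNIV \<sigma> (\<sigma> x) = x"
  using bij by (auto simp: bij_is_surj surj_f_inv_f bij_is_inj)

lemma zpow_0 [simp]: "zpow \<sigma> 0 x = x"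
  by (simp add: zpow_def)

lemma zpow_succ: "zpow \<sigma> (n + 1) x = \<sigma> (zpow \<sigma> n x)"
proof (cases "0 \<le> n")
  case True
  then show ?thesis by (simp add: zpow_def nat_add_distrib)
next
  case False
  then obtain k where "n = - int (Suc k)" by (cases n rule: int_cases) auto
  then show ?thesis by (cases k) (simp_all add: zpow_def bij_cancel nat_add_distrib)
qed

lemma zpow_pred: "zpow \<sigma> (n - 1) x = inv_into UNIV \<sigma> (zpow \<sigma> n x)"
  using zpow_succ [of "n - 1" x] by (simp add: bij_cancel)

lemma zpow_add: "zpow \<sigma> (m + n) x = zpow \<sigma> n (zpow \<sigma> m x)"
proof (induction n rule: int_induct [where k = 0])
  case (step1 i)
  then show ?case using zpow_succ [of "m + i" x] by (simp add: zpow_succ add.assoc)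
next
  case (step2 i)
  then show ?case using zpow_pred [of "m + i" x] by (simp add: zpow_pred algebra_simps)
qed simp

lemma zpow_neg_eq_iff: "zpow \<sigma> (- n) x = y \<longleftrightarrow> zpow \<sigma> n y = x"
  using zpow_add [of "- n" n x] zpow_add [of n "- n" y] by auto

lemma zpow_orbit_iff:
  "(\<exists>n. zpow \<sigma> n x = y) \<longleftrightarrow> (\<exists>n. (\<sigma> ^^ n) x = y \<or> (\<sigma> ^^ n) y = x)"
proof
  assume "\<exists>n. zpow \<sigma> n x = y"
  then obtain n where n: "zpow \<sigma> n x = y" by blast
  show "\<exists>n. (\<sigma> ^^ n) x = y \<or> (\<sigma> ^^ n) y = x"
  proof (cases "0 \<le> n")
    case True
    then show ?thesis using n by (auto simp: zpow_def)
  next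
    case False
    have "zpow \<sigma> (- n) y = x" using n zpow_neg_eq_iff by blast
    then show ?thesis using False by (auto simp: zpow_def)
  qed
next
  assume "\<exists>n. (\<sigma> ^^ n) x = y \<or> (\<sigma> ^^ n) y = x"
  then obtain n where "zpow \<sigma> (int n) x = y \<or> zpow \<sigma> (int n) y = x" by (auto simp: zpow_def)
  then show "\<exists>n. zpow \<sigma> n x = y" using zpow_neg_eq_iff by blast
qed

lemma zpow_free:
  assumes "\<And>n x. (\<sigma> ^^ n) x = x \<Longrightarrow> n = 0" and "zpow \<sigma> n x = x" shows "n = 0"
proof (cases "0 \<le> n")
  case True
  then show ?thesis using assms(1) [of "nat n" x] assms(2) by (simp add: zpow_def)
next
  case False
  have "zpow \<sigma> (- n) x = x" using assms(2) zpow_neg_eq_iff by blast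
  then show ?thesis using assms(1) [of "nat (- n)" x] False by (simp add: zpow_def)
qed

end

lemma computable_zpow:
  fixes \<sigma> :: "'x::coded \<Rightarrow> 'x"
  assumes "computable \<sigma>" "bij \<sigma>" "computable f" "computable g"
  shows "computable (\<lambda>p. zpow \<sigma> (int_decode (g p)) (f p))"
proof -
  have "computable (\<lambda>p. if even (g p) then (\<sigma> ^^ (g p div 2)) (f p)
      else (inv_into UNIV \<sigma> ^^ Suc (g p div 2)) (f p))"
    by (intro comp_intros assms computable_compose [OF assms(1)]
        computable_compose [OF computable_inv [OF assms(1,2)]])
  moreover have "zpow \<sigma> (int_decode n) x = (if even n then (\<sigma> ^^ (n div 2)) x
      else (inv_into UNIV \<sigma> ^^ Suc (n div 2)) x)" for n x
  proof -
    have "nat (- (- int k - 1)) = Suc k" for k by simp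
    then show ?thesis by (simp add: zpow_def int_decode_def sum_decode_def)
  qed
  ultimately show ?thesis by simp
qed

section \<open>Words and the word metric\<close>

context group
begin

lemma letters_closed: "S \<subseteq> carrier G \<Longrightarrow> letters G S \<subseteq> carrier G"
  by (auto simp: letters_def)

lemma inv_letters: "S \<subseteq> carrier G \<Longrightarrow> a \<in> letters G S \<Longrightarrow> inv a \<in> letters G S"
  by (auto simp: letters_def)

lemma word_value_Nil [simp]: "word_value G [] = \<one>"
  by (simp add: word_value_def)

lemma word_value_Cons [simp]: "word_value G (a # w) = a \<otimes> word_value G w"
  by (simp add: word_value_def)

lemma word_value_closed: "set w \<subseteq> carrier G \<Longrightarrow> word_value G w \<in> carrier G"
  by (induction w) auto

lemma word_value_append:
  "set u \<subseteq> carrier G \<Longrightarrow> set v \<subseteq> carrier G \<Longrightarrow> word_value G (u @ v) = word_value G u \<otimes> word_value G v"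
  by (induction u) (auto simp: word_value_closed m_assoc)

lemma word_value_rev_inv:
  "set w \<subseteq> carrier G \<Longrightarrow> word_value G (rev (map (m_inv G) w)) = inv (word_value G w)"
proof (induction w)
  case (Cons a w)
  then have "set (rev (map (m_inv G) w)) \<subseteq> carrier G" by auto
  with Cons show ?case by (simp add: word_value_append word_value_closed inv_mult_group)
qed simp

lemma generate_word:
  assumes "S \<subseteq> carrier G" "x \<in> generate G S"
  shows "\<exists>w\<in>lists (letters G S). word_value G w = x"
  using assms(2)
proof (induction rule: generate.induct)
  case one
  show ?case by (intro bexI [of _ "[]"]) auto
next
  case (incl h)
  then show ?case using assms(1) by (intro bexI [of _ "[h]"]) (auto simp: letters_def)
next
  case (inv h)
  then show ?case using assms(1) by (intro bexI [of _ "[inv h]"]) (auto simp: letters_def)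
next
  case (eng h1 h2)
  then obtain u v where "u \<in> lists (letters G S)" "word_value G u = h1"
      "v \<in> lists (letters G S)" "word_value G v = h2" by blast
  moreover from this have "word_value G (u @ v) = h1 \<otimes> h2"
    using letters_closed [OF assms(1)] by (subst word_value_append) (auto simp: lists_eq_set)
  ultimately show ?case by (intro bexI [of _ "u @ v"]) auto
qed

end

locale generated_group = group G for G :: "('a, 'b) monoid_scheme" (structure) +
  fixes S :: "'a set"
  assumes S_finite: "finite S" and S_closed: "S \<subseteq> carrier G" and S_generates: "generate G S = carrier G"
begin

abbreviation "A \<equiv> letters G S"

lemma lists_A: "w \<in> lists A \<Longrightarrow> set w \<subseteq> carrier G"
  using letters_closed [OF S_closed] by auto

text \<open>
  There is a word of length exactly \<open>n\<close> leading from \<open>g\<close> to \<open>h\<close>; the word metric is the least such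
  \<open>n\<close>, and the metric axioms come from reversing and concatenating words.
\<close>
definition joins :: "'a \<Rightarrow> 'a \<Rightarrow> nat \<Rightarrow> bool" where
  "joins g h n \<longleftrightarrow> (\<exists>w\<in>lists A. length w = n \<and> g \<otimes> word_value G w = h)"

lemma word_metric_eq:
  "g \<in> carrier G \<Longrightarrow> h \<in> carrier G \<Longrightarrow> word_metric G S g h = real (LEAST n. joins g h n)"
  by (simp add: word_metric_def joins_def)

lemma joins_ex:
  assumes "g \<in> carrier G" "h \<in> carrier G" shows "\<exists>n. joins g h n"
proof -
  obtain w where "w \<in> lists A" "word_value G w = inv g \<otimes> h"
    using generate_word [OF S_closed, of "inv g \<otimes> h"] S_generates assms by auto
  moreover from this have "g \<otimes> word_value G w = h" using assms by (simp add: m_assoc [symmetric])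
  ultimately show ?thesis unfolding joins_def by blast
qed

lemma joins_sym:
  assumes "g \<in> carrier G" "h \<in> carrier G" "joins g h n" shows "joins h g n"
proof -
  obtain w where w: "w \<in> lists A" "length w = n" "g \<otimes> word_value G w = h"
    using assms(3) by (auto simp: joins_def)
  have "rev (map (m_inv G) w) \<in> lists A" using w(1) inv_letters [OF S_closed] by auto
  moreover have "h \<otimes> word_value G (rev (map (m_inv G) w)) = g"
    unfolding w(3) [symmetric] word_value_rev_inv [OF lists_A [OF w(1)]]
    using assms(1) word_value_closed [OF lists_A [OF w(1)]] by (simp add: m_assoc)
  ultimately show ?thesis using w(2) by (auto simp: joins_def intro!: bexI [of _ "rev (map (m_inv G) w)"])
qed

lemma joins_trans:
  assumes "g \<in> carrier G" "joins g h m" "joins h k n" shows "joins g k (m + n)"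
proof -
  obtain u v where u: "u \<in> lists A" "length u = m" "g \<otimes> word_value G u = h"
    and v: "v \<in> lists A" "length v = n" "h \<otimes> word_value G v = k"
    using assms(2,3) by (auto simp: joins_def)
  have "g \<otimes> word_value G (u @ v) = k"
    using assms(1) u v lists_A [OF u(1)] lists_A [OF v(1)]
    by (auto simp: word_value_append word_value_closed m_assoc)
  then show ?thesis using u v by (auto simp: joins_def intro!: bexI [of _ "u @ v"])
qed

lemma word_metric_le:
  "g \<in> carrier G \<Longrightarrow> h \<in> carrier G \<Longrightarrow> joins g h n \<Longrightarrow> word_metric G S g h \<le> real n"
  by (simp add: word_metric_eq Least_le)

lemma joins_word_metric:
  "g \<in> carrier G \<Longrightarrow> h \<in> carrier G \<Longrightarrow> \<exists>n. joins g h n \<and> word_metric G S g h = real n"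
  using joins_ex [of g h] LeastI_ex [of "joins g h"] by (auto simp: word_metric_eq)

lemma Metric_space_word_metric: "Metric_space (carrier G) (word_metric G S)"
proof
  fix x y z
  show "0 \<le> word_metric G S x y" by (simp add: word_metric_def)
  show "word_metric G S x y = word_metric G S y x"
  proof (cases "x \<in> carrier G \<and> y \<in> carrier G")
    case True
    then have "joins x y = joins y x" using joins_sym [of x y] joins_sym [of y x] by auto
    with True show ?thesis by (simp add: word_metric_eq)
  qed (auto simp: word_metric_def)
  assume x: "x \<in> carrier G" and y: "y \<in> carrier G"
  show "word_metric G S x y = 0 \<longleftrightarrow> x = y"
  proof
    assume "word_metric G S x y = 0"
    then have "joins x y 0" using joins_word_metric [OF x y] by auto
    then show "x = y" using x by (auto simp: joins_def)
  next
    assume "x = y"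
    then have "joins x y 0" using x by (auto simp: joins_def intro!: bexI [of _ "[]"])
    then have "word_metric G S x y \<le> real 0" by (rule word_metric_le [OF x y])
    then show "word_metric G S x y = 0" by (simp add: word_metric_eq x y)
  qed
  assume z: "z \<in> carrier G"
  obtain m n where "joins x y m" "word_metric G S x y = real m" "joins y z n" "word_metric G S y z = real n"
    using joins_word_metric [OF x y] joins_word_metric [OF y z] by auto
  then show "word_metric G S x z \<le> word_metric G S x y + word_metric G S y z"
    using word_metric_le [OF x z joins_trans [OF x]] by fastforce
qed

end

section \<open>A computable numbering of the group\<close>

locale decidable_group = generated_group G S
  for G :: "('a, 'b) monoid_scheme" (structure) and S +
  fixes e :: "'a \<Rightarrow> nat"
  assumes infinite_carrier: "infinite (carrier G)"
    and e_bij: "bij_betw e A {..<card A}"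
    and word_problem: "decidable_set (word_code e ` {w \<in> lists A. word_value G w = \<one>})"
begin

text \<open>
  Every list of numbers is made to denote a word, by skipping the entries that do not code a letter. This
  saves all side conditions when programs manipulate words.
\<close>
definition decode :: "nat list \<Rightarrow> 'a list" where
  "decode w = map (inv_into A e) (filter (\<lambda>i. i < card A) w)"

definition val :: "nat list \<Rightarrow> 'a" where
  "val w = word_value G (decode w)"

lemma decode_lists: "decode w \<in> lists A"
  using bij_betwE [OF bij_betw_inv_into [OF e_bij]] by (auto simp: decode_def)

lemma decode_encode: "w \<in> lists A \<Longrightarrow> decode (map e w) = w"
proof (induction w)
  case (Cons a w)
  then have "e a < card A" "inv_into A e (e a) = a"
    using e_bij by (auto simp: bij_betw_def)
  with Cons show ?case by (simp add: decode_def)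
qed (simp add: decode_def)

lemma encode_decode: "map e (decode w) = filter (\<lambda>i. i < card A) w"
  unfolding decode_def map_map
  by (rule map_idI) (use bij_betw_inv_into_right [OF e_bij] in auto)

lemma val_closed [simp]: "val w \<in> carrier G"
  unfolding val_def by (rule word_value_closed [OF lists_A [OF decode_lists]])

lemma val_append: "val (u @ v) = val u \<otimes> val v"
proof -
  have "decode (u @ v) = decode u @ decode v" by (simp add: decode_def)
  then show ?thesis
    unfolding val_def by (simp add: word_value_append lists_A [OF decode_lists])
qed

lemma val_encode: "w \<in> lists A \<Longrightarrow> val (map e w) = word_value G w"
  by (simp add: val_def decode_encode)

lemma val_surj: "x \<in> carrier G \<Longrightarrow> \<exists>w. val w = x"
  using generate_word [OF S_closed, of x] S_generates val_encode by metis

lemma computable_val_one: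
  assumes "computable f" shows "computable (\<lambda>x. val (f x) = \<one>)"
proof -
  let ?L = "{w \<in> lists A. word_value G w = \<one>}"
  have "computable (\<lambda>x. enc (filter (\<lambda>i. i < card A) (f x)) \<in> word_code e ` ?L)"
    by (intro computable_compose [OF word_problem [unfolded decidable_set_iff_computable]]
        comp_intros assms)
  moreover have "enc (filter (\<lambda>i. i < card A) w) \<in> word_code e ` ?L \<longleftrightarrow> val w = \<one>" for w
  proof -
    have enc: "enc w = list_encode w" for w :: "nat list"
      by (simp add: enc_list_def enc_nat_def [abs_def])
    show ?thesis
    proof
      assume "enc (filter (\<lambda>i. i < card A) w) \<in> word_code e ` ?L"
      then obtain u where u: "u \<in> ?L" "enc (filter (\<lambda>i. i < card A) w) = word_code e u" by blast
      then have "map e (decode w) = map e u"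
        by (simp add: enc word_code_def list_encode_eq encode_decode)
      with u(1) show "val w = \<one>"
        using decode_encode [of u] decode_encode [OF decode_lists, of w] by (simp add: val_def)
    next
      assume "val w = \<one>"
      then have "decode w \<in> ?L" using decode_lists by (simp add: val_def)
      moreover have "enc (filter (\<lambda>i. i < card A) w) = word_code e (decode w)"
        by (simp add: enc word_code_def encode_decode)
      ultimately show "enc (filter (\<lambda>i. i < card A) w) \<in> word_code e ` ?L" by blast
    qed
  qed
  ultimately show ?thesis by simp
qed

text \<open>
  Comparing two words reduces to the word problem once an inverse of a word is computable, and such an
  inverse can be searched for with the word problem itself.
\<close>
lemma computable_val_eq:
  assumes "computable f" "computable g" shows "computable (\<lambda>x. val (f x) = val (g x))"
proof -
  have "\<exists>v. val (u @ v) = \<one>" for u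
  proof -
    obtain v where "val v = inv (val u)" using val_surj [of "inv (val u)"] by auto
    then have "val (u @ v) = \<one>" by (simp add: val_append)
    then show ?thesis ..
  qed
  moreover have "computable (\<lambda>p. val (fst p @ snd p) = \<one>)"
    by (intro computable_val_one comp_intros)
  ultimately obtain inverse_word where iw: "computable inverse_word" "\<And>u. val (u @ inverse_word u) = \<one>"
    using computable_choice [of "\<lambda>u v. val (u @ v) = \<one>"] by blast
  have "val u = val v \<longleftrightarrow> val (u @ inverse_word v) = \<one>" for u v
  proof -
    have "val (u @ inverse_word v) = \<one> \<longleftrightarrow> val u \<otimes> val (inverse_word v) = val v \<otimes> val (inverse_word v)"
      using iw(2) [of v] by (simp add: val_append)
    then show ?thesis by simp
  qed
  moreover have "computable (\<lambda>x. val (f x @ inverse_word (g x)) = \<one>)"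
    by (intro computable_val_one comp_intros assms computable_compose [OF iw(1)])
  ultimately show ?thesis by simp
qed

text \<open>
  The names of the elements are the positions in the increasing list of those codes of words that are least for
  the element they represent. This list is infinite because the group is, so every natural number is
  a name. The product of two names is computed by concatenating the words that they stand for and looking up the
  name of the result.
\<close>
proposition computable_numbering_exists:
  "\<exists>(\<nu> :: nat \<Rightarrow> 'a) idx mul. bij_betw \<nu> UNIV (carrier G) \<and> computable idx \<and> (\<forall>w. \<nu> (idx w) = val w) \<and>
     computable (\<lambda>p. mul (fst p) (snd p)) \<and> (\<forall>m n. \<nu> (mul m n) = \<nu> m \<otimes> \<nu> n)"
proof -
  define D where "D = {n. \<forall>k\<in>set [0..<n]. val (dec k) \<noteq> val (dec n)}"
  have "computable (\<lambda>n. \<forall>k\<in>set [0..<n]. \<not> val (dec k) = val (dec n))"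
    by (intro comp_intros computable_val_eq)
  then have comp_D: "computable (\<lambda>n. n \<in> D)" by (simp add: D_def)
  have surj_D: "\<exists>n\<in>D. val (dec n) = x" if x_in: "x \<in> carrier G" for x
  proof
    obtain w where "val w = x" using val_surj [OF x_in] by blast
    then have "val (dec (enc w)) = x" by simp
    then have ex: "\<exists>n. val (dec n) = x" ..
    show x: "val (dec (LEAST n. val (dec n) = x)) = x" by (rule LeastI_ex [OF ex])
    show "(LEAST n. val (dec n) = x) \<in> D"
      unfolding D_def mem_Collect_eq x
    proof
      fix k assume "k \<in> set [0..<LEAST n. val (dec n) = x]"
      then have "k < (LEAST n. val (dec n) = x)" by (simp only: set_upt atLeastLessThan_iff)
      then show "val (dec k) \<noteq> x" by (rule not_less_Least)
    qed
  qed
  have inf_D: "infinite D"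
  proof
    assume "finite D"
    then have "finite ((\<lambda>n. val (dec n)) ` D)" by simp
    moreover have "carrier G \<subseteq> (\<lambda>n. val (dec n)) ` D" using surj_D by (auto simp: image_iff)
    ultimately show False using infinite_carrier finite_subset by blast
  qed
  define rep :: "nat \<Rightarrow> nat list" where "rep n = dec (enumerate D n)" for n
  define \<nu> where "\<nu> n = val (rep n)" for n
  have comp_rep: "computable rep"
    unfolding rep_def by (intro comp_intros computable_enumerate comp_D inf_D)
  have bij: "bij_betw \<nu> UNIV (carrier G)"
  proof -
    have "inj_on (\<lambda>n. val (dec n)) D"
    proof (rule inj_onI)
      fix m n assume "m \<in> D" "n \<in> D" "val (dec m) = val (dec n)"
      then show "m = n" by (cases m n rule: linorder_cases) (auto simp: D_def)
    qed
    then have "bij_betw (\<lambda>n. val (dec n)) D (carrier G)"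
      using surj_D by (auto simp: bij_betw_def image_iff)
    then have "bij_betw ((\<lambda>n. val (dec n)) \<circ> enumerate D) UNIV (carrier G)"
      using bij_enumerate [OF inf_D] by (rule bij_betw_trans [rotated])
    moreover have "(\<lambda>n. val (dec n)) \<circ> enumerate D = \<nu>" by (simp add: \<nu>_def rep_def fun_eq_iff)
    ultimately show ?thesis by simp
  qed
  have "\<exists>n. \<nu> n = val w" for w
    using bij val_closed [of w] by (metis bij_betw_imp_surj_on imageE)
  moreover have "computable (\<lambda>p. \<nu> (snd p) = val (fst p))"
    unfolding \<nu>_def by (intro computable_val_eq comp_intros computable_compose [OF comp_rep])
  ultimately obtain idx where idx: "computable idx" "\<And>w. \<nu> (idx w) = val w"
    using computable_choice [of "\<lambda>w n. \<nu> n = val w"] by blast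
  have "computable (\<lambda>p. idx (rep (fst p) @ rep (snd p)))"
    by (intro comp_intros computable_compose [OF idx(1)] computable_compose [OF comp_rep])
  moreover have "\<nu> (idx (rep m @ rep n)) = \<nu> m \<otimes> \<nu> n" for m n
    unfolding idx(2) val_append by (simp add: \<nu>_def)
  ultimately show ?thesis
    using bij idx by (intro exI [of _ \<nu>] exI [of _ idx] exI [of _ "\<lambda>m n. idx (rep m @ rep n)"]) auto
qed

text \<open>
  The numbering transports the group and its Cayley graph to the natural numbers, where the results on
  computable Cayley graphs apply. Adding the neutral element to the generators makes the edge relation
  reflexive.
\<close>
proposition computable_permutation_exists:
  fixes \<nu> :: "nat \<Rightarrow> 'a"
  assumes bij: "bij_betw \<nu> UNIV (carrier G)"
    and comp: "computable (\<lambda>p. mul (fst p) (snd p))"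
    and mul: "\<And>m n. \<nu> (mul m n) = \<nu> m \<otimes> \<nu> n"
  shows "\<exists>\<sigma> k. computable \<sigma> \<and> bij \<sigma> \<and> (\<forall>n x. (\<sigma> ^^ n) x = x \<longrightarrow> n = 0) \<and>
    (\<forall>x. word_metric G S (\<nu> x) (\<nu> (\<sigma> x)) \<le> real k) \<and>
    computable (\<lambda>p. \<exists>n. (\<sigma> ^^ n) (fst p) = snd p \<or> (\<sigma> ^^ n) (snd p) = fst p)"
proof -
  have closed [simp]: "\<nu> x \<in> carrier G" for x using bij by (auto simp: bij_betw_def)
  have inj: "\<nu> x = \<nu> y \<longleftrightarrow> x = y" for x y using bij by (auto simp: bij_betw_def inj_eq)
  have surj: "\<exists>x. \<nu> x = a" if "a \<in> carrier G" for a
    using bij that by (metis bij_betw_imp_surj_on imageE)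
  obtain u where u: "\<nu> u = \<one>" using surj by blast
  define H where "H = \<lparr>carrier = UNIV :: nat set, monoid.mult = mul, one = u\<rparr>"
  have "group H"
  proof (rule groupI)
    fix x assume "x \<in> carrier H"
    obtain y where "\<nu> y = inv (\<nu> x)" using surj [of "inv (\<nu> x)"] by auto
    then have "mul y x = u" by (simp add: mul u flip: inj)
    then show "\<exists>y\<in>carrier H. y \<otimes>\<^bsub>H\<^esub> x = \<one>\<^bsub>H\<^esub>" by (auto simp: H_def)
  qed (auto simp: H_def mul m_assoc u simp flip: inj)
  have "finite A" using S_finite by (simp add: letters_def)
  then have "finite (\<nu> -` insert \<one> A)"
    using bij by (intro finite_vimageI) (auto simp: bij_betw_def)
  then obtain gens where gens: "set gens = \<nu> -` insert \<one> A" using finite_list by blast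
  define nb where "nb x = map (\<lambda>s. mul x s) gens" for x
  define E where "E = {(x, y). y \<in> set (nb x)}"
  have E_iff: "(x, y) \<in> E \<longleftrightarrow> (\<exists>s\<in>insert \<one> A. \<nu> y = \<nu> x \<otimes> s)" for x y
  proof
    assume "(x, y) \<in> E"
    then show "\<exists>s\<in>insert \<one> A. \<nu> y = \<nu> x \<otimes> s" by (auto simp: E_def nb_def gens mul)
  next
    assume "\<exists>s\<in>insert \<one> A. \<nu> y = \<nu> x \<otimes> s"
    then obtain s where s: "s \<in> insert \<one> A" "\<nu> y = \<nu> x \<otimes> s" by blast
    then obtain t where "\<nu> t = s" using surj letters_closed [OF S_closed] by blast
    then have "y = mul x t" "t \<in> set gens" using s by (auto simp: mul gens simp flip: inj)
    then show "(x, y) \<in> E" by (auto simp: E_def nb_def)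
  qed
  have walk: "(x, y) \<in> rtrancl E" if "w \<in> lists A" "\<nu> y = \<nu> x \<otimes> word_value G w" for w x y
    using that
  proof (induction w arbitrary: x)
    case Nil
    then show ?case by (simp add: inj)
  next
    case (Cons a w)
    have a: "a \<in> A" "a \<in> carrier G" "w \<in> lists A" using Cons.hyps letters_closed [OF S_closed] by auto
    obtain z where z: "\<nu> z = \<nu> x \<otimes> a" using surj [of "\<nu> x \<otimes> a"] a by auto
    have "\<nu> y = \<nu> z \<otimes> word_value G w"
      using Cons.prems a z word_value_closed [OF lists_A [OF a(3)]] by (simp add: m_assoc)
    then have "(z, y) \<in> rtrancl E" by (rule Cons.IH)
    moreover have "(x, z) \<in> E" using z a by (auto simp: E_iff)
    ultimately show ?case by (rule converse_rtrancl_into_rtrancl [rotated])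
  qed
  interpret H: computable_cayley_graph E nb H
  proof (intro computable_cayley_graph.intro computable_graph.intro computable_cayley_graph_axioms.intro
      computable_graph_axioms.intro graph.intro \<open>group H\<close>)
    show "(x, x) \<in> E" for x by (auto simp: E_iff)
    show "(y, x) \<in> E" if "(x, y) \<in> E" for x y
    proof -
      obtain s where s: "s \<in> insert \<one> A" "\<nu> y = \<nu> x \<otimes> s" using \<open>(x, y) \<in> E\<close> unfolding E_iff by blast
      then have "s \<in> carrier G" using letters_closed [OF S_closed] by auto
      then have "\<nu> x = \<nu> y \<otimes> inv s" using s(2) by (simp add: m_assoc)
      moreover have "inv s \<in> insert \<one> A" using s(1) inv_letters [OF S_closed] by auto
      ultimately show ?thesis unfolding E_iff by blast
    qed
    show "finite (E `` {x})" for x by (simp add: E_def Image_def)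
    show "(x, y) \<in> rtrancl E" for x y
    proof -
      obtain w where w: "w \<in> lists A" "\<nu> x \<otimes> word_value G w = \<nu> y"
        using joins_ex [OF closed [of x] closed [of y]] unfolding joins_def by blast
      show ?thesis by (rule walk [OF w(1) w(2) [symmetric]])
    qed
    show "(x, y) \<in> E \<longleftrightarrow> y \<in> set (nb x)" for x y by (simp add: E_def)
    show "computable nb"
      unfolding nb_def by (intro comp_intros computable_compose2 [OF comp])
    show "carrier H = UNIV" by (simp add: H_def)
    show "(g \<otimes>\<^bsub>H\<^esub> x, g \<otimes>\<^bsub>H\<^esub> y) \<in> E" if "(x, y) \<in> E" for g x y
    proof -
      obtain s where s: "s \<in> insert \<one> A" "\<nu> y = \<nu> x \<otimes> s" using \<open>(x, y) \<in> E\<close> unfolding E_iff by blast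
      then have "s \<in> carrier G" using letters_closed [OF S_closed] by auto
      then have "\<nu> (mul g y) = \<nu> (mul g x) \<otimes> s" using s(2) by (simp add: mul m_assoc)
      then show ?thesis using s(1) unfolding E_iff H_def by auto
    qed
    show "computable (\<lambda>p. fst p \<otimes>\<^bsub>H\<^esub> snd p)" using comp by (simp add: H_def)
  qed
  obtain \<sigma> where "H.tame_free_permutation \<sigma>" using H.tame_free_permutation_exists by blast
  then obtain k where \<sigma>: "computable \<sigma>" "bij \<sigma>" "\<And>x. (x, \<sigma> x) \<in> E ^^ k"
      "\<And>n x. (\<sigma> ^^ n) x = x \<Longrightarrow> n = 0"
      "computable (\<lambda>p. \<exists>n. (\<sigma> ^^ n) (fst p) = snd p \<or> (\<sigma> ^^ n) (snd p) = fst p)"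
    unfolding H.tame_free_permutation_def by blast
  have "\<exists>j\<le>n. joins (\<nu> x) (\<nu> y) j" if "(x, y) \<in> E ^^ n" for x y n
    using that
  proof (induction n arbitrary: y)
    case 0
    then show ?case by (auto simp: joins_def intro!: bexI [of _ "[]"])
  next
    case (Suc n)
    then obtain z where z: "(x, z) \<in> E ^^ n" "(z, y) \<in> E" by auto
    obtain j where j: "j \<le> n" "joins (\<nu> x) (\<nu> z) j" using Suc.IH [OF z(1)] by blast
    obtain s where s: "s \<in> insert \<one> A" "\<nu> y = \<nu> z \<otimes> s" using z(2) unfolding E_iff by blast
    show ?case
    proof (cases "s = \<one>")
      case True
      then show ?thesis using j s by (intro exI [of _ j]) simp
    next
      case False
      then have "joins (\<nu> z) (\<nu> y) 1"
        using s letters_closed [OF S_closed] by (auto simp: joins_def intro!: bexI [of _ "[s]"])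
      then have "joins (\<nu> x) (\<nu> y) (j + 1)" by (rule joins_trans [OF closed j(2)])
      then show ?thesis using j(1) by (intro exI [of _ "j + 1"]) simp
    qed
  qed
  then have "word_metric G S (\<nu> x) (\<nu> (\<sigma> x)) \<le> real k" for x
    using \<sigma>(3) [of x] word_metric_le [of "\<nu> x" "\<nu> (\<sigma> x)"] by fastforce
  then show ?thesis using \<sigma> by blast
qed

end

section \<open>The translation-like action\<close>

text \<open>
  The integers act through the powers of the permutation of names, so the displacement of \<open>n\<close> is at most
  \<open>\<bar>n\<bar>\<close> times that of the permutation.
\<close>
theorem theorem1p7:
  fixes G :: "('a, 'b) monoid_scheme" and S :: "'a set"
  assumes "group G"
    and "infinite (carrier G)"
    and "finite S" and "S \<subseteq> carrier G" and "generate G S = carrier G"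
    and "decidable_word_problem G S"
  shows "\<exists>act :: 'a \<Rightarrow> int \<Rightarrow> 'a.
           translation_like_action integer_group (carrier G) (word_metric G S) act \<and>
           computable_int_action G act \<and>
           decidable_orbit_membership G S integer_group act"
proof -
  interpret group G by (rule assms(1))
  obtain e where e: "bij_betw e (letters G S) {..<card (letters G S)}"
      "decidable_set (word_code e ` {w \<in> lists (letters G S). word_value G w = \<one>\<^bsub>G\<^esub>})"
    using assms(6) unfolding decidable_word_problem_def decidable_words_def by blast
  interpret decidable_group G S e
    by unfold_locales (use assms e in auto)
  obtain \<nu> :: "nat \<Rightarrow> 'a" and idx mul where bij: "bij_betw \<nu> UNIV (carrier G)"
    and idx: "computable idx" "\<And>w. \<nu> (idx w) = val w"
    and mul: "computable (\<lambda>p. mul (fst p) (snd p))" "\<And>m n. \<nu> (mul m n) = \<nu> m \<otimes>\<^bsub>G\<^esub> \<nu> n"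
    using computable_numbering_exists by blast
  obtain \<sigma> k where \<sigma>: "computable \<sigma>" "bij \<sigma>" and \<sigma>_free: "\<forall>n x. (\<sigma> ^^ n) x = x \<longrightarrow> n = 0"
    and \<sigma>_bdd: "\<forall>x. word_metric G S (\<nu> x) (\<nu> (\<sigma> x)) \<le> real k"
    and \<sigma>_orbit: "computable (\<lambda>p. \<exists>n. (\<sigma> ^^ n) (fst p) = snd p \<or> (\<sigma> ^^ n) (snd p) = fst p)"
    using computable_permutation_exists [OF bij mul] by blast
  have \<nu>_in: "\<nu> x \<in> carrier G" for x using bij by (auto simp: bij_betw_def)
  define name where "name = inv_into UNIV \<nu>"
  have name_\<nu>: "name (\<nu> x) = x" for x
    using bij by (simp add: name_def bij_betw_inv_into_left)
  have \<nu>_name: "\<nu> (name g) = g" if "g \<in> carrier G" for g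
    using bij that by (simp add: name_def bij_betw_inv_into_right)
  define act where "act g n = \<nu> (zpow \<sigma> n (name g))" for g n
  have action: "right_action integer_group (carrier G) act"
  proof (intro right_action.intro right_action_axioms.intro)
    fix x and m n :: int assume "x \<in> carrier G"
    show "act x \<one>\<^bsub>integer_group\<^esub> = x"
      using \<open>x \<in> carrier G\<close> by (simp add: act_def zpow_0 [OF \<sigma>(2)] \<nu>_name)
    show "act x (m \<otimes>\<^bsub>integer_group\<^esub> n) = act (act x m) n"
      by (simp add: act_def zpow_add [OF \<sigma>(2)] name_\<nu>)
  qed (simp_all add: act_def \<nu>_in)
  have displacement: "word_metric G S x (act x n) \<le> \<bar>n\<bar> * real k" if x: "x \<in> carrier G" for x n
  proof -
    interpret Metric_space "carrier G" "word_metric G S" by (rule Metric_space_word_metric)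
    have nonneg: "word_metric G S (\<nu> a) (\<nu> ((\<sigma> ^^ m) a)) \<le> m * real k" for a m
    proof (induction m)
      case (Suc m)
      have "word_metric G S (\<nu> a) (\<nu> ((\<sigma> ^^ Suc m) a)) \<le>
          word_metric G S (\<nu> a) (\<nu> ((\<sigma> ^^ m) a)) + word_metric G S (\<nu> ((\<sigma> ^^ m) a)) (\<nu> ((\<sigma> ^^ Suc m) a))"
        by (intro triangle \<nu>_in)
      then show ?case using Suc spec [OF \<sigma>_bdd, of "(\<sigma> ^^ m) a"] by (simp add: algebra_simps)
    qed (simp add: \<nu>_in)
    show ?thesis
    proof (cases "0 \<le> n")
      case True
      then show ?thesis
        using nonneg [of "name x" "nat n"] by (simp add: act_def zpow_def \<nu>_name x)
    next
      case False
      have "zpow \<sigma> (- n) (zpow \<sigma> n (name x)) = name x"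
        using zpow_add [OF \<sigma>(2), of n "- n" "name x"] by (simp add: zpow_0 [OF \<sigma>(2)])
      then have "(\<sigma> ^^ nat (- n)) (zpow \<sigma> n (name x)) = name x"
        using False by (simp add: zpow_def)
      then show ?thesis
        using nonneg [of "zpow \<sigma> n (name x)" "nat (- n)"] False
        by (simp add: act_def \<nu>_name x commute)
    qed
  qed
  have "translation_like_action integer_group (carrier G) (word_metric G S) act"
  proof (intro translation_like_action.intro translation_like_action_axioms.intro
      action Metric_space_word_metric)
    fix x and n :: int assume x: "x \<in> carrier G" and "act x n = x"
    then have "zpow \<sigma> n (name x) = name x" by (metis act_def name_\<nu>)
    then show "n = \<one>\<^bsub>integer_group\<^esub>" using zpow_free [OF \<sigma>(2), of n "name x"] \<sigma>_free by simp
  next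
    fix n :: int
    show "bounded {word_metric G S x (act x n) |x. x \<in> carrier G}"
      using displacement [of _ n] by (intro boundedI [of _ "\<bar>n\<bar> * real k"]) (auto simp: word_metric_def)
  qed
  moreover have "computable_int_action G act"
  proof -
    have UNIV: "prod_names UNIV UNIV = UNIV"
      using surj_prod_encode by (auto simp: prod_names_def)
    have "computable_group_numbering G UNIV \<nu>"
    proof -
      have "computable (\<lambda>n. mul (fst (prod_decode n)) (snd (prod_decode n)))"
        by (intro computable_compose2 [OF mul(1)] comp_intros)
      then have "rec1 (\<lambda>n. mul (fst (prod_decode n)) (snd (prod_decode n)))"
        by (simp add: computable_rec1)
      moreover have "name (\<nu> m \<otimes>\<^bsub>G\<^esub> \<nu> n) = mul m n" for m n
        by (simp add: name_\<nu> flip: mul(2))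
      ultimately show ?thesis
        using bij computable_const [of True]
        by (simp add: computable_group_numbering_def numbering_def computable_map_def UNIV
            decidable_set_iff_computable prod_numbering_def rec1_def case_prod_beta flip: name_def)
    qed
    moreover have "computable_map (prod_names UNIV UNIV) (prod_numbering \<nu> int_decode) UNIV \<nu> (\<lambda>(g, n). act g n)"
    proof -
      have "computable (\<lambda>n. zpow \<sigma> (int_decode (snd (prod_decode n))) (fst (prod_decode n)))"
        by (intro computable_zpow \<sigma> comp_intros)
      then have "rec1 (\<lambda>n. zpow \<sigma> (int_decode (snd (prod_decode n))) (fst (prod_decode n)))"
        by (simp add: computable_rec1)
      then show ?thesis
        by (simp add: computable_map_def UNIV prod_numbering_def rec1_def case_prod_beta act_def name_\<nu>
            flip: name_def)
    qed
    ultimately show ?thesis unfolding computable_int_action_def by blast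
  qed
  moreover have "decidable_orbit_membership G S integer_group act"
  proof -
    let ?orbit = "action_orbit integer_group act"
    have orbit_eq: "?orbit (\<nu> x) = ?orbit (\<nu> y) \<longleftrightarrow> (\<exists>n. (\<sigma> ^^ n) x = y \<or> (\<sigma> ^^ n) y = x)" for x y
    proof -
      have orbit: "?orbit (\<nu> z) = {\<nu> (zpow \<sigma> n z) | n. True}" for z
        by (simp add: action_orbit_def act_def name_\<nu>)
      have "?orbit (\<nu> x) = ?orbit (\<nu> y) \<longleftrightarrow> (\<exists>n. zpow \<sigma> n x = y)"
      proof
        assume "?orbit (\<nu> x) = ?orbit (\<nu> y)"
        moreover have "\<nu> y \<in> ?orbit (\<nu> y)"
          unfolding orbit using zpow_0 [OF \<sigma>(2), of y] by (metis (mono_tags, lifting) mem_Collect_eq)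
        ultimately obtain n where "\<nu> y = \<nu> (zpow \<sigma> n x)" unfolding orbit by blast
        then show "\<exists>n. zpow \<sigma> n x = y" by (metis name_\<nu>)
      next
        assume "\<exists>n. zpow \<sigma> n x = y"
        then obtain n where n: "y = zpow \<sigma> n x" by blast
        have y: "zpow \<sigma> m y = zpow \<sigma> (n + m) x" and x: "zpow \<sigma> m x = zpow \<sigma> (m - n) y" for m
          using zpow_add [OF \<sigma>(2), of n m x] zpow_add [OF \<sigma>(2), of n "m - n" x] by (simp_all add: n)
        show "?orbit (\<nu> x) = ?orbit (\<nu> y)" unfolding orbit
        proof (intro equalityI subsetI)
          fix t assume "t \<in> {\<nu> (zpow \<sigma> m x) | m. True}"
          then obtain m where "t = \<nu> (zpow \<sigma> m x)" by blast
          then have "t = \<nu> (zpow \<sigma> (m - n) y)" by (simp only: x)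
          then show "t \<in> {\<nu> (zpow \<sigma> m y) | m. True}" by blast
        next
          fix t assume "t \<in> {\<nu> (zpow \<sigma> m y) | m. True}"
          then obtain m where "t = \<nu> (zpow \<sigma> m y)" by blast
          then have "t = \<nu> (zpow \<sigma> (n + m) x)" by (simp only: y)
          then show "t \<in> {\<nu> (zpow \<sigma> m x) | m. True}" by blast
        qed
      qed
      then show ?thesis using zpow_orbit_iff [OF \<sigma>(2)] by simp
    qed
    define orb where "orb p \<longleftrightarrow> (\<exists>n. (\<sigma> ^^ n) (fst p) = snd p \<or> (\<sigma> ^^ n) (snd p) = fst p)" for p
    let ?R = "{(u, v). u \<in> lists (letters G S) \<and> v \<in> lists (letters G S) \<and>
                ?orbit (word_value G u) = ?orbit (word_value G v)}"
    let ?code = "\<lambda>(u, v). prod_encode (word_code e u, word_code e v)"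
    have code: "enc (map e u, map e v) = ?code (u, v)" for u v
      by (simp add: enc_prod_def enc_list_def enc_nat_def [abs_def] word_code_def)
    have inR: "(u, v) \<in> ?R \<longleftrightarrow> orb (idx (map e u), idx (map e v))"
      if "u \<in> lists (letters G S)" "v \<in> lists (letters G S)" for u v
      using that orbit_eq [of "idx (map e u)" "idx (map e v)"] by (simp add: orb_def idx(2) val_encode)
    have e_less: "\<forall>i\<in>set (map e u). i < card (letters G S)" if "u \<in> lists (letters G S)" for u
      using e(1) that by (auto simp: bij_betw_def)
    have "n \<in> ?code ` ?R \<longleftrightarrow>
        (let p = dec n :: nat list \<times> nat list in
          (\<forall>i\<in>set (fst p). i < card (letters G S)) \<and> (\<forall>i\<in>set (snd p). i < card (letters G S)) \<and>
          orb (idx (fst p), idx (snd p)))" (is "_ \<longleftrightarrow> ?D n") for n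
    proof
      assume "n \<in> ?code ` ?R"
      then obtain u v where uv: "(u, v) \<in> ?R" "n = ?code (u, v)" by blast
      then have "dec n = (map e u, map e v)" using code [of u v] by (metis dec_enc)
      then show "?D n" using uv(1) inR [of u v] e_less [of u] e_less [of v] by (simp add: Let_def)
    next
      assume D: "?D n"
      define u v where "u = decode (fst (dec n :: nat list \<times> nat list))"
        and "v = decode (snd (dec n :: nat list \<times> nat list))"
      have uv: "map e u = fst (dec n :: nat list \<times> nat list)" "map e v = snd (dec n :: nat list \<times> nat list)"
        using D by (simp_all add: u_def v_def encode_decode Let_def)
      have in_lists: "u \<in> lists (letters G S)" "v \<in> lists (letters G S)"
        by (simp_all only: u_def v_def decode_lists)
      have "n = enc (dec n :: nat list \<times> nat list)"
        by (simp add: enc_prod_def dec_prod_def enc_list_def dec_list_def enc_nat_def [abs_def] dec_nat_def [abs_def])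
      then have "n = ?code (u, v)" using code [of u v] by (simp add: uv)
      moreover have "(u, v) \<in> ?R" using D inR [OF in_lists] by (simp add: uv Let_def)
      ultimately show "n \<in> ?code ` ?R" by blast
    qed
    moreover have "computable ?D"
      unfolding Let_def orb_def
      by (intro comp_intros computable_compose [OF \<sigma>_orbit] computable_compose [OF idx(1)])
    ultimately have "decidable_set (?code ` ?R)" by (simp add: decidable_set_iff_computable)
    with e(1) show ?thesis
      unfolding decidable_orbit_membership_def decidable_word_pairs_def by blast
  qed
  ultimately show ?thesis by blast
qed

end
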